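(* Let $A\subset\mathbb R$ be a compact interval with diameter $\Delta$, let $\mu_1,\mu_2,\nu_1,\nu_2$ be four probability measures supported on $A$, and let $t\in(0,1)$. For $K>\Delta$ let $\tau_K:x\mapsto x+K$ and $$\mu:=(1-t)\mu_1+t\,\tau_{K\#}\mu_2,\qquad \nu:=(1-t)\nu_1+t\,\tau_{K\#}\nu_2.$$ Then for $K$ large enough, the unique optimal plan for the squared distance Gromov--Wasserstein problem $$\min_{\pi\in\Pi(\mu,\nu)}\int\int\big|(x-x')^2-(y-y')^2\big|^2\,d\pi(x,y)\,d\pi(x',y')$$ between $\mu$ and $\nu$ is given by one of the two monotone rearrangements (non-decreasing or non-increasing) between $\mu$ and $\nu$.
   Context: $\Pi(\mu,\nu)$ is the set of probability measures on $\mathbb R\times\mathbb R$ with marginals $\mu$ and $\nu$; $\tau_{K\#}$ denotes pushforward by $\tau_K$. The non-decreasing rearrangement between $\mu$ and $\nu$ is the plan that matches the quantiles of $\mu$ and $\nu$ with each other, i.e. the law of $(F_\mu^{-1}(U),F_\nu^{-1}(U))$ with $U$ uniform on $(0,1)$ and $F_\mu^{-1},F_\nu^{-1}$ the quantile functions; the non-increasing rearrangement matches the quantiles in reverse, i.e. it is the law of $(F_\mu^{-1}(U),F_\nu^{-1}(1-U))$.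
   Formalization: Uniqueness is claimed only if t ≠ 1/2 or the two monotone rearrangements have different costs; in a tie at t = 1/2 (e.g. all four measures δ_0) both are optimal, so uniqueness fails. Existence, and that every optimal plan is one of the two, hold for all t. *)

theory Defs
  imports "HOL-Probability.Probability"
begin

definition mixture :: "real \<Rightarrow> real measure \<Rightarrow> real measure \<Rightarrow> real measure" where
  "mixture t M N =
    measure_of UNIV (sets borel) (\<lambda>B. ennreal (1 - t) * emeasure M B + ennreal t * emeasure N B)"

definition couplings :: "real measure \<Rightarrow> real measure \<Rightarrow> (real \<times> real) measure set" where
  "couplings \<mu> \<nu> =
    {\<pi>. prob_space \<pi> \<and> sets \<pi> = sets borel \<and> distr \<pi> borel fst = \<mu> \<and> distr \<pi> borel snd = \<nu>}"

text \<open>The integrand is nonnegative, so the cost is taken in the extended nonnegative reals; this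
  avoids the default value 0 of the Bochner integral for non-integrable functions.\<close>

definition gw_cost :: "(real \<times> real) measure \<Rightarrow> ennreal" where
  "gw_cost \<pi> =
    (\<integral>\<^sup>+ (x', y'). (\<integral>\<^sup>+ (x, y). ennreal (\<bar>(x - x')\<^sup>2 - (y - y')\<^sup>2\<bar>\<^sup>2) \<partial>\<pi>) \<partial>\<pi>)"

definition gw_optimal :: "real measure \<Rightarrow> real measure \<Rightarrow> (real \<times> real) measure \<Rightarrow> bool" where
  "gw_optimal \<mu> \<nu> \<pi> \<longleftrightarrow> is_arg_min gw_cost (\<lambda>\<pi>'. \<pi>' \<in> couplings \<mu> \<nu>) \<pi>"

definition quantile :: "real measure \<Rightarrow> real \<Rightarrow> real" where
  "quantile M u = Inf {x. u \<le> cdf M x}"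

text \<open>Lebesgue measure restricted to the open unit interval is the law of a uniform variable.\<close>

definition nondecreasing_rearrangement ::
    "real measure \<Rightarrow> real measure \<Rightarrow> (real \<times> real) measure" where
  "nondecreasing_rearrangement \<mu> \<nu> =
    distr (restrict_space lborel {0<..<1}) borel (\<lambda>u. (quantile \<mu> u, quantile \<nu> u))"

definition nonincreasing_rearrangement ::
    "real measure \<Rightarrow> real measure \<Rightarrow> (real \<times> real) measure" where
  "nonincreasing_rearrangement \<mu> \<nu> =
    distr (restrict_space lborel {0<..<1}) borel (\<lambda>u. (quantile \<mu> u, quantile \<nu> (1 - u)))"

text \<open>\<^const>\<open>measure_of\<close> and \<^const>\<open>distr\<close> return degenerate measures when their side conditions
  fail; the following facts show that they hold here.\<close>

lemma sets_mixture [simp, measurable_cong]: "sets (mixture t M N) = sets borel"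
  unfolding mixture_def using sets.sigma_sets_eq[of "borel :: real measure"] by simp

lemma emeasure_mixture:
  assumes "sets M = sets borel" "sets N = sets borel" "B \<in> sets borel"
  shows "emeasure (mixture t M N) B = ennreal (1 - t) * emeasure M B + ennreal t * emeasure N B"
proof (rule emeasure_measure_of[OF mixture_def])
  show "sets borel \<subseteq> Pow (UNIV :: real set)" by simp
  show "B \<in> sets (mixture t M N)" using assms by simp
  show "positive (sets (mixture t M N))
      (\<lambda>B. ennreal (1 - t) * emeasure M B + ennreal t * emeasure N B)"
    by (simp add: positive_def)
  show "countably_additive (sets (mixture t M N))
      (\<lambda>B. ennreal (1 - t) * emeasure M B + ennreal t * emeasure N B)"
  proof (rule countably_additiveI)
    fix F :: "nat \<Rightarrow> real set"
    assume F: "range F \<subseteq> sets (mixture t M N)" "disjoint_family F"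
    have "(\<Sum>i. emeasure M (F i)) = emeasure M (\<Union>i. F i)"
      "(\<Sum>i. emeasure N (F i)) = emeasure N (\<Union>i. F i)"
      using F assms by (auto intro!: suminf_emeasure)
    then show "(\<Sum>i. ennreal (1 - t) * emeasure M (F i) + ennreal t * emeasure N (F i)) =
        ennreal (1 - t) * emeasure M (\<Union>i. F i) + ennreal t * emeasure N (\<Union>i. F i)"
      by (simp add: suminf_add[symmetric] ennreal_suminf_cmult)
  qed
qed

lemma real_distribution_mixture:
  assumes "real_distribution M" "real_distribution N" "0 \<le> t" "t \<le> 1"
  shows "real_distribution (mixture t M N)"
proof -
  interpret M: real_distribution M by fact
  interpret N: real_distribution N by fact
  have "space (mixture t M N) = UNIV"
    using sets_eq_imp_space_eq[OF sets_mixture] by simp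
  then have "prob_space (mixture t M N)"
    using assms M.emeasure_space_1 N.emeasure_space_1
    by (intro prob_spaceI) (simp add: emeasure_mixture flip: ennreal_plus)
  then show ?thesis
    by (simp add: real_distribution_def real_distribution_axioms_def)
qed

lemma measurable_quantile:
  assumes "real_distribution M"
  shows "quantile M \<in> borel_measurable (restrict_space borel {0<..<1})"
    and "distr (restrict_space lborel {0<..<1}) borel (quantile M) = M"
proof -
  interpret cdf_distribution M
    using assms by (simp add: cdf_distribution_def)
  have "quantile M = (\<lambda>u. Inf {x. u \<le> cdf M x})"
    by (simp add: quantile_def fun_eq_iff)
  then show "quantile M \<in> borel_measurable (restrict_space borel {0<..<1})"
    "distr (restrict_space lborel {0<..<1}) borel (quantile M) = M"
    using measurable_CI distr_I_eq_M by simp_all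
qed

lemma measurable_quantile_reflect:
  assumes "real_distribution M"
  shows "(\<lambda>u. quantile M (1 - u)) \<in> borel_measurable (restrict_space borel {0<..<1})"
  by (rule measurable_compose[OF _ measurable_quantile(1)[OF assms]])
    (rule measurable_restrict_space3, auto)

end

theory Submission
  imports Defs
begin

text \<open>
  In coordinates centred at the means, expanding the square shows that the cost of a coupling \<open>\<pi>\<close> is
  a constant minus \<open>4 (E[X\<^sup>2 Y\<^sup>2] + 2 Cov(X, Y)\<^sup>2)\<close>. By Hoeffding's identity the difference of
  \<open>E[X\<^sup>2 Y\<^sup>2] + 2 Cov(X, Y)\<^sup>2\<close> between the comonotone coupling \<open>\<pi>\<^sub>0\<close> and \<open>\<pi>\<close> is
  \<open>4 \<integral>\<integral> ((u - m)(v - n) + s) D(u,v) du dv\<close>, where \<open>D \<ge> 0\<close> is the difference of the joint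
  survival functions, \<open>m\<close> and \<open>n\<close> are the means and \<open>s\<close> is the average of the two covariances.

  Let \<open>p\<close> be the mass that \<open>\<pi>\<close> sends from the lower to the upper cluster. The weight is positive on
  the two corners where both coordinates lie on the same side of the gap. Everywhere else \<open>D \<le> p\<close>,
  with \<open>D = p\<close> on the square where both coordinates lie in the gap between the clusters. That square
  contributes about \<open>K\<^sup>4 p (1/4 - p/2)\<close>, which dominates the \<open>O(p R K\<^sup>3)\<close> of the remaining region as
  long as \<open>p\<close> stays away from \<open>1/2\<close>. Since \<open>p \<le> min t (1 - t)\<close>, only \<open>t = 1/2\<close> needs more: if
  \<open>p > 1/4\<close>, reflecting the second coordinate replaces \<open>p\<close> by \<open>1/2 - p\<close>, and the non-increasing
  rearrangement takes over the role of the comonotone coupling.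
\<close>

subsection \<open>Integrals over rectangles\<close>

lemma ex_in_box_if_AE_lborel:
  fixes a b :: "'a :: euclidean_space"
  assumes "AE x in lborel. x \<in> box a b \<longrightarrow> P x" and "box a b \<noteq> {}"
  shows "\<exists>x\<in>box a b. P x"
proof (rule ccontr)
  assume "\<not> ?thesis"
  with assms(1) have "AE x in lborel. x \<notin> box a b" by (auto elim!: eventually_mono)
  then have "emeasure lborel (box a b) = 0"
    by (subst (asm) AE_iff_measurable[OF _ refl]) auto
  moreover have "0 < emeasure lborel (box a b)"
    using \<open>box a b \<noteq> {}\<close>
    by (auto simp: emeasure_lborel_box_eq box_ne_empty less_imp_le inner_diff_left intro!: prod_pos)
  ultimately show False by simp
qed

lemma (in pair_sigma_finite)
  fixes f :: "'a \<Rightarrow> real" and g :: "'b \<Rightarrow> real"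
  assumes f: "integrable M1 f" and g: "integrable M2 g"
  shows integrable_times: "integrable (M1 \<Otimes>\<^sub>M M2) (\<lambda>z. f (fst z) * g (snd z))"
    and integral_times:
      "(\<integral>z. f (fst z) * g (snd z) \<partial>(M1 \<Otimes>\<^sub>M M2)) = integral\<^sup>L M1 f * integral\<^sup>L M2 g"
proof -
  note [measurable] = borel_measurable_integrable[OF f] borel_measurable_integrable[OF g]
  show int: "integrable (M1 \<Otimes>\<^sub>M M2) (\<lambda>z. f (fst z) * g (snd z))"
    by (rule Fubini_integrable) (use f g in \<open>auto simp: abs_mult\<close>)
  show "(\<integral>z. f (fst z) * g (snd z) \<partial>(M1 \<Otimes>\<^sub>M M2)) = integral\<^sup>L M1 f * integral\<^sup>L M2 g"
    using integral_fst'[OF int] by simp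
qed

lemma
  fixes f g :: "real \<Rightarrow> real"
  assumes "set_integrable lborel A f" "set_integrable lborel B g"
  shows set_integrable_lborel_Times: "set_integrable lborel (A \<times> B) (\<lambda>w. f (fst w) * g (snd w))"
    and set_integral_lborel_Times:
      "(LBINT w:A \<times> B. f (fst w) * g (snd w)) = (LBINT u:A. f u) * (LBINT v:B. g v)"
proof -
  have times: "indicator (A \<times> B) w *\<^sub>R (f (fst w) * g (snd w)) =
      (indicator A (fst w) *\<^sub>R f (fst w)) * (indicator B (snd w) *\<^sub>R g (snd w))" for w
    by (cases w) (simp add: indicator_times)
  show "set_integrable lborel (A \<times> B) (\<lambda>w. f (fst w) * g (snd w))"
    using lborel_pair.integrable_times[OF assms[unfolded set_integrable_def]]
    by (simp only: set_integrable_def times lborel_prod)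
  show "(LBINT w:A \<times> B. f (fst w) * g (snd w)) = (LBINT u:A. f u) * (LBINT v:B. g v)"
    using lborel_pair.integral_times[OF assms[unfolded set_integrable_def]]
    by (simp only: set_lebesgue_integral_def times lborel_prod)
qed

lemma set_integrable_Ioo:
  fixes f :: "real \<Rightarrow> real"
  assumes "continuous_on {a..b} f"
  shows "set_integrable lborel {a<..<b} f"
  by (rule set_integrable_subset[OF borel_integrable_atLeastAtMost'[OF assms]]) auto

lemma LBINT_Ioo_FTC:
  fixes f F :: "real \<Rightarrow> real"
  assumes "a \<le> b" "continuous_on {a..b} f"
    and "\<And>x. x \<in> {a..b} \<Longrightarrow> (F has_real_derivative f x) (at x within {a..b})"
  shows "(LBINT x:{a<..<b}. f x) = F b - F a"
proof -
  have "(LBINT x=a..b. f x) = F b - F a"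
    using assms
    by (intro interval_integral_FTC_finite)
      (auto simp flip: has_real_derivative_iff_has_vector_derivative)
  then show ?thesis using \<open>a \<le> b\<close> by (simp add: interval_integral_Ioo)
qed

lemma LBINT_lessThan_indicator_FTC:
  fixes f F :: "real \<Rightarrow> real"
  assumes "x \<in> {a..b}" "continuous_on UNIV f" "\<And>x. (F has_real_derivative f x) (at x)"
  shows "(LBINT u:{..<x}. indicator {a<..<b} u * f u) = F x - F a"
proof -
  have "(LBINT u:{..<x}. indicator {a<..<b} u * f u) = (LBINT u:{a<..<x}. f u)"
    unfolding set_lebesgue_integral_def using assms(1)
    by (intro Bochner_Integration.integral_cong) (auto simp: indicator_def)
  also have "\<dots> = F x - F a"
    using assms(1)
    by (intro LBINT_Ioo_FTC continuous_on_subset[OF assms(2)]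
        has_field_derivative_at_within[OF assms(3)]) auto
  finally show ?thesis .
qed

lemma
  fixes a a' b b' :: real
  shows fmeasurable_lborel_Ioo_Times: "{a<..<a'} \<times> {b<..<b'} \<in> fmeasurable lborel"
    and measure_lborel_Ioo_Times:
      "a \<le> a' \<Longrightarrow> b \<le> b' \<Longrightarrow> measure lborel ({a<..<a'} \<times> {b<..<b'}) = (a' - a) * (b' - b)"
proof -
  have box: "{a<..<a'} \<times> {b<..<b'} = box (a, b) (a', b')" by (simp add: box_prod)
  show "{a<..<a'} \<times> {b<..<b'} \<in> fmeasurable lborel" by (simp add: box)
  show "measure lborel ({a<..<a'} \<times> {b<..<b'}) = (a' - a) * (b' - b)" if "a \<le> a'" "b \<le> b'"
    using that by (simp add: box measure_lborel_box_eq Basis_prod_def)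
qed

lemma
  fixes c :: real
  assumes "A \<in> fmeasurable M"
  shows set_integrable_const_fmeasurable: "set_integrable M A (\<lambda>x. c)"
    and set_integral_const_fmeasurable: "(LINT x:A|M. c) = c * measure M A"
  using assms fmeasurableD[OF assms] fmeasurableD2[OF assms]
  by (simp_all add: set_integrable_def fmeasurable_def set_integral_const)

lemma
  fixes f :: "'a \<Rightarrow> real"
  assumes Q: "Q \<in> fmeasurable M" and S: "S \<in> sets M" "S \<subseteq> Q" and f: "set_integrable M S f"
  shows set_integrable_indicator_minus_const: "set_integrable M Q (\<lambda>x. indicator S x * f x - c)"
    and set_integral_indicator_minus_const:
      "(LINT x:Q|M. indicator S x * f x - c) = (LINT x:S|M. f x) - c * measure M Q"
proof -
  have restrict: "indicator Q x *\<^sub>R (indicator S x * f x) = indicator S x *\<^sub>R f x" for x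
    using S(2) by (auto simp: indicator_def)
  then have int_S: "set_integrable M Q (\<lambda>x. indicator S x * f x)"
    and eq: "(LINT x:Q|M. indicator S x * f x) = (LINT x:S|M. f x)"
    using f by (simp_all only: set_integrable_def set_lebesgue_integral_def restrict)
  note int_c = set_integrable_const_fmeasurable[OF Q, of c]
  show "set_integrable M Q (\<lambda>x. indicator S x * f x - c)"
    by (intro set_integral_diff(1) int_S int_c)
  show "(LINT x:Q|M. indicator S x * f x - c) = (LINT x:S|M. f x) - c * measure M Q"
    by (simp add: set_integral_diff(2)[OF int_S int_c] eq set_integral_const_fmeasurable[OF Q])
qed

lemma
  fixes a a' b b' m n c :: real
  assumes "a \<le> a'" "b \<le> b'"
  shows set_integrable_bilinear: "set_integrable lborel ({a<..<a'} \<times> {b<..<b'})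
      (\<lambda>w. (fst w - m) * (snd w - n) + c)"
    and set_integral_bilinear: "(LBINT w:{a<..<a'} \<times> {b<..<b'}. (fst w - m) * (snd w - n) + c) =
      (a' - a) * (b' - b) * (((a + a') / 2 - m) * ((b + b') / 2 - n) + c)"
proof -
  have linear: "set_integrable lborel {l<..<r} (\<lambda>x. x - k)" for l r k :: real
    by (intro set_integrable_Ioo continuous_intros)
  have midpoint: "(LBINT x:{l<..<r}. x - k) = (r - l) * ((l + r) / 2 - k)"
    if "l \<le> r" for l r k :: real
  proof -
    have "((\<lambda>x. (x - k)\<^sup>2 / 2) has_real_derivative x - k) (at x)" for x :: real
      by (auto intro!: derivative_eq_intros)
    from LBINT_Ioo_FTC[OF that _ has_field_derivative_at_within[OF this]] show ?thesis
      by (simp add: continuous_intros power2_eq_square field_simps)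
  qed
  note const = set_integrable_const_fmeasurable[OF fmeasurable_lborel_Ioo_Times[of a a' b b'], of c]
  have const_eq: "(LBINT w:{a<..<a'} \<times> {b<..<b'}. c) = (a' - a) * (b' - b) * c"
    using assms
    by (simp add: set_integral_const_fmeasurable fmeasurable_lborel_Ioo_Times
        measure_lborel_Ioo_Times)
  show "set_integrable lborel ({a<..<a'} \<times> {b<..<b'}) (\<lambda>w. (fst w - m) * (snd w - n) + c)"
    by (intro set_integral_add(1) set_integrable_lborel_Times linear const)
  show "(LBINT w:{a<..<a'} \<times> {b<..<b'}. (fst w - m) * (snd w - n) + c) =
      (a' - a) * (b' - b) * (((a + a') / 2 - m) * ((b + b') / 2 - n) + c)"
    unfolding set_integral_add(2)[OF set_integrable_lborel_Times[OF linear linear] const]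
      set_integral_lborel_Times[OF linear linear] midpoint[OF assms(1)] midpoint[OF assms(2)]
      const_eq
    by (simp only: distrib_left mult_ac)
qed

subsection \<open>Distributions on the plane\<close>

locale planar_distribution = prob_space \<pi> for \<pi> :: "(real \<times> real) measure" +
  assumes sets_eq_borel: "sets \<pi> = sets borel"
begin

lemma sets_eq_borel_pair [simp, measurable_cong]: "sets \<pi> = sets (borel \<Otimes>\<^sub>M borel)"
  unfolding borel_prod by (rule sets_eq_borel)

lemma space_eq_UNIV [simp]: "space \<pi> = UNIV"
  using sets_eq_imp_space_eq[OF sets_eq_borel] by simp

lemma planar_distribution_distr:
  assumes "T \<in> borel \<rightarrow>\<^sub>M borel"
  shows "planar_distribution (distr \<pi> borel T)"
proof -
  have "random_variable borel T"
    using assms by (simp add: measurable_cong_sets[OF sets_eq_borel refl])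
  then show ?thesis
    by (simp add: planar_distribution_def planar_distribution_axioms_def prob_space_distr)
qed

end

definition joint_survival :: "(real \<times> real) measure \<Rightarrow> real \<times> real \<Rightarrow> real" where
  "joint_survival \<pi> w = measure \<pi> ({fst w<..} \<times> {snd w<..})"

lemma sets_borel_eq_sigma_sets_quadrants:
  "sets (borel :: (real \<times> real) measure) = sigma_sets UNIV (range (\<lambda>w. {fst w<..} \<times> {snd w<..}))"
proof -
  have "{x. eucl_less w x} = {fst w<..} \<times> {snd w<..}" for w :: "real \<times> real"
    by (auto simp: eucl_less_def Basis_prod_def inner_prod_def)
  then show ?thesis
    using arg_cong[OF borel_eq_greaterThan[where 'a = "real \<times> real"], of sets] by simp
qed

lemma planar_distribution_eqI_joint_survival:
  assumes "planar_distribution \<pi>" "planar_distribution \<pi>'"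
    and eq: "joint_survival \<pi> = joint_survival \<pi>'"
  shows "\<pi> = \<pi>'"
proof -
  interpret P: planar_distribution \<pi> by fact
  interpret P': planar_distribution \<pi>' by fact
  let ?quadrant = "\<lambda>w :: real \<times> real. {fst w<..} \<times> {snd w<..}"
  show ?thesis
  proof (rule measure_eqI_generator_eq)
    show "Int_stable (range ?quadrant)"
    proof (rule Int_stableI_image)
      fix w z :: "real \<times> real"
      have "?quadrant w \<inter> ?quadrant z = ?quadrant (max (fst w) (fst z), max (snd w) (snd z))"
        by auto
      then show "\<exists>y\<in>UNIV. ?quadrant w \<inter> ?quadrant z = ?quadrant y" by blast
    qed
    show "emeasure \<pi> X = emeasure \<pi>' X" if "X \<in> range ?quadrant" for X
      using that fun_cong[OF eq]
      by (auto simp: joint_survival_def P.emeasure_eq_measure P'.emeasure_eq_measure)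
    show "sets \<pi> = sigma_sets UNIV (range ?quadrant)" "sets \<pi>' = sigma_sets UNIV (range ?quadrant)"
      by (simp_all only: P.sets_eq_borel P'.sets_eq_borel sets_borel_eq_sigma_sets_quadrants)
    show "range (\<lambda>i. ?quadrant (- real i, - real i)) \<subseteq> range ?quadrant" by blast
    show "(\<Union>i. ?quadrant (- real i, - real i)) = UNIV"
    proof safe
      fix x y :: real
      obtain i where "max (- x) (- y) < real i" using reals_Archimedean2 by blast
      then have "(x, y) \<in> ?quadrant (- real i, - real i)" by auto
      then show "(x, y) \<in> (\<Union>i. ?quadrant (- real i, - real i))" by blast
    qed auto
  qed auto
qed

context planar_distribution
begin

lemma joint_survival_antimono:
  assumes "fst w \<le> fst z" "snd w \<le> snd z"
  shows "joint_survival \<pi> z \<le> joint_survival \<pi> w"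
  unfolding joint_survival_def using assms by (intro finite_measure_mono) auto

lemma joint_survival_right_continuous:
  "(\<lambda>k. joint_survival \<pi> (u + inverse (Suc k), v + inverse (Suc k))) \<longlonglongrightarrow> joint_survival \<pi> (u, v)"
proof -
  let ?Q = "\<lambda>k. {u + inverse (real (Suc k))<..} \<times> {v + inverse (real (Suc k))<..}"
  have "(\<lambda>k. prob (?Q k)) \<longlonglongrightarrow> prob (\<Union>k. ?Q k)"
  proof (rule finite_Lim_measure_incseq)
    show "incseq ?Q"
    proof (rule incseq_SucI)
      fix k
      have "inverse (real (Suc (Suc k))) \<le> inverse (real (Suc k))" by (simp add: field_simps)
      then show "?Q k \<subseteq> ?Q (Suc k)" by (intro Sigma_mono) auto
    qed
  qed auto
  moreover have "(\<Union>k. ?Q k) = {u<..} \<times> {v<..}"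
  proof safe
    fix x y k assume "u + inverse (real (Suc k)) < x" "v + inverse (real (Suc k)) < y"
    moreover have "0 < inverse (real (Suc k))" by simp
    ultimately show "u < x" "v < y" by linarith+
  next
    fix x y assume "u < x" "v < y"
    then obtain k where "inverse (real (Suc k)) < min (x - u) (y - v)"
      using reals_Archimedean[of "min (x - u) (y - v)"] by auto
    then have "(x, y) \<in> ?Q k" by (simp add: algebra_simps)
    then show "(x, y) \<in> (\<Union>k. ?Q k)" by blast
  qed
  ultimately show ?thesis by (simp add: joint_survival_def)
qed

end

lemma joint_survival_le_if_AE_le:
  assumes "planar_distribution \<pi>" "planar_distribution \<pi>'" and "u < u'" "v < v'"
    and AE_le: "AE w in lborel. w \<in> {u<..<u'} \<times> {v<..<v'} \<longrightarrow>
      joint_survival \<pi> w \<le> joint_survival \<pi>' w"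
  shows "joint_survival \<pi> (u, v) \<le> joint_survival \<pi>' (u, v)"
proof -
  interpret P: planar_distribution \<pi> by fact
  interpret P': planar_distribution \<pi>' by fact
  have le: "joint_survival \<pi> (u + \<epsilon>, v + \<epsilon>) \<le> joint_survival \<pi>' (u, v)"
    if "0 < \<epsilon>" "\<epsilon> < min (u' - u) (v' - v)" for \<epsilon>
  proof -
    have box: "box (u, v) (u + \<epsilon>, v + \<epsilon>) = {u<..<u + \<epsilon>} \<times> {v<..<v + \<epsilon>}"
      by (auto simp: box_def Basis_prod_def)
    have "\<exists>w\<in>box (u, v) (u + \<epsilon>, v + \<epsilon>). joint_survival \<pi> w \<le> joint_survival \<pi>' w"
    proof (rule ex_in_box_if_AE_lborel)
      show "AE w in lborel. w \<in> box (u, v) (u + \<epsilon>, v + \<epsilon>) \<longrightarrow>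
          joint_survival \<pi> w \<le> joint_survival \<pi>' w"
        using AE_le by eventually_elim (use that in \<open>auto simp: box\<close>)
      show "box (u, v) (u + \<epsilon>, v + \<epsilon>) \<noteq> {}" using that by (simp add: box)
    qed
    then obtain w where w: "w \<in> {u<..<u + \<epsilon>} \<times> {v<..<v + \<epsilon>}"
      and "joint_survival \<pi> w \<le> joint_survival \<pi>' w" unfolding box by blast
    moreover have "joint_survival \<pi> (u + \<epsilon>, v + \<epsilon>) \<le> joint_survival \<pi> w"
      using w by (intro P.joint_survival_antimono) auto
    moreover have "joint_survival \<pi>' w \<le> joint_survival \<pi>' (u, v)"
      using w by (intro P'.joint_survival_antimono) auto
    ultimately show ?thesis by linarith
  qed
  obtain N where N: "inverse (real (Suc N)) < min (u' - u) (v' - v)"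
    using reals_Archimedean[of "min (u' - u) (v' - v)"] \<open>u < u'\<close> \<open>v < v'\<close> by auto
  show ?thesis
  proof (rule LIMSEQ_le_const2[OF P.joint_survival_right_continuous], intro exI allI impI)
    fix k assume "N \<le> k"
    then have "inverse (real (Suc k)) \<le> inverse (real (Suc N))" by (simp add: field_simps)
    also note N
    finally show "joint_survival \<pi> (u + inverse (Suc k), v + inverse (Suc k)) \<le>
        joint_survival \<pi>' (u, v)"
      by (intro le) simp_all
  qed
qed

subsection \<open>Couplings\<close>

lemma planar_distribution_coupling:
  assumes "\<pi> \<in> couplings \<mu> \<nu>"
  shows "planar_distribution \<pi>"
  using assms by (simp add: couplings_def planar_distribution_def planar_distribution_axioms_def)

lemma
  assumes \<pi>: "\<pi> \<in> couplings \<mu> \<nu>" and [measurable]: "B \<in> sets borel" "C \<in> sets borel"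
  shows measure_fst_coupling: "measure \<mu> B = measure \<pi> (B \<times> C) + measure \<pi> (B \<times> (- C))"
    and measure_snd_coupling: "measure \<nu> C = measure \<pi> (B \<times> C) + measure \<pi> ((- B) \<times> C)"
proof -
  interpret planar_distribution \<pi> using \<pi> by (rule planar_distribution_coupling)
  have "measure \<mu> B = prob (B \<times> UNIV)"
    using \<pi> by (auto simp: couplings_def measure_distr vimage_fst)
  also have "B \<times> UNIV = B \<times> C \<union> B \<times> (- C)" by auto
  also have "prob \<dots> = prob (B \<times> C) + prob (B \<times> (- C))" by (rule finite_measure_Union) auto
  finally show "measure \<mu> B = prob (B \<times> C) + prob (B \<times> (- C))" .
  have "measure \<nu> C = prob (UNIV \<times> C)"
    using \<pi> by (auto simp: couplings_def measure_distr vimage_snd)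
  also have "UNIV \<times> C = B \<times> C \<union> (- B) \<times> C" by auto
  also have "prob \<dots> = prob (B \<times> C) + prob ((- B) \<times> C)" by (rule finite_measure_Union) auto
  finally show "measure \<nu> C = prob (B \<times> C) + prob ((- B) \<times> C)" .
qed

lemma
  assumes \<pi>: "\<pi> \<in> couplings \<mu> \<nu>" and [measurable]: "(h :: real \<Rightarrow> real) \<in> borel_measurable borel"
  shows integral_fst_coupling: "(\<integral>z. h (fst z) \<partial>\<pi>) = integral\<^sup>L \<mu> h"
    and integral_snd_coupling: "(\<integral>z. h (snd z) \<partial>\<pi>) = integral\<^sup>L \<nu> h"
proof -
  interpret planar_distribution \<pi> using \<pi> by (rule planar_distribution_coupling)
  show "(\<integral>z. h (fst z) \<partial>\<pi>) = integral\<^sup>L \<mu> h" "(\<integral>z. h (snd z) \<partial>\<pi>) = integral\<^sup>L \<nu> h"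
    using \<pi> by (auto simp: couplings_def integral_distr)
qed

lemma AE_coupling_Times:
  assumes \<pi>: "\<pi> \<in> couplings \<mu> \<nu>" and [measurable]: "B \<in> sets borel" "C \<in> sets borel"
    and "AE x in \<mu>. x \<in> B" "AE y in \<nu>. y \<in> C"
  shows "AE z in \<pi>. z \<in> B \<times> C"
proof -
  interpret planar_distribution \<pi> using \<pi> by (rule planar_distribution_coupling)
  have "AE x in distr \<pi> borel fst. x \<in> B" "AE y in distr \<pi> borel snd. y \<in> C"
    using \<pi> assms(4,5) by (auto simp: couplings_def)
  then have "AE z in \<pi>. fst z \<in> B" "AE z in \<pi>. snd z \<in> C" by (simp_all add: AE_distr_iff)
  then show ?thesis by eventually_elim (simp add: mem_Times_iff)
qed

definition comonotone_coupling :: "real measure \<Rightarrow> real measure \<Rightarrow> (real \<times> real) measure \<Rightarrow> bool" where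
  "comonotone_coupling \<mu> \<nu> \<pi> \<longleftrightarrow> \<pi> \<in> couplings \<mu> \<nu> \<and>
    (\<forall>u v. joint_survival \<pi> (u, v) = min (measure \<mu> {u<..}) (measure \<nu> {v<..}))"

lemma comonotone_couplingD: "comonotone_coupling \<mu> \<nu> \<pi> \<Longrightarrow> \<pi> \<in> couplings \<mu> \<nu>"
  by (simp add: comonotone_coupling_def)

lemma joint_survival_le_comonotone:
  assumes "\<pi> \<in> couplings \<mu> \<nu>" "comonotone_coupling \<mu> \<nu> \<pi>\<^sub>0"
  shows "joint_survival \<pi> w \<le> joint_survival \<pi>\<^sub>0 w"
  using measure_fst_coupling[OF assms(1), of "{fst w<..}" "{snd w<..}"]
    measure_snd_coupling[OF assms(1), of "{fst w<..}" "{snd w<..}"] assms(2)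
  by (cases w) (simp add: comonotone_coupling_def joint_survival_def)

subsection \<open>Hoeffding's covariance identity\<close>

context planar_distribution
begin

lemma integrable_quadrant_kernel:
  fixes f g :: "real \<Rightarrow> real"
  assumes f: "integrable lborel f" and g: "integrable lborel g"
  shows "integrable (\<pi> \<Otimes>\<^sub>M (lborel \<Otimes>\<^sub>M lborel))
    (\<lambda>(z, w). if fst w < fst z \<and> snd w < snd z then f (fst w) * g (snd w) else 0)"
proof (rule Bochner_Integration.integrable_bound)
  interpret pair_sigma_finite \<pi> "lborel \<Otimes>\<^sub>M lborel :: (real \<times> real) measure" ..
  note [measurable] = borel_measurable_integrable[OF f] borel_measurable_integrable[OF g]
  show "integrable (\<pi> \<Otimes>\<^sub>M (lborel \<Otimes>\<^sub>M lborel)) (\<lambda>q. 1 * (f (fst (snd q)) * g (snd (snd q))))"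
    using integrable_times[of "\<lambda>_. 1", OF _ lborel_pair.integrable_times[OF f g]] by simp
  show "(\<lambda>(z, w). if fst w < fst z \<and> snd w < snd z then f (fst w) * g (snd w) else 0)
      \<in> borel_measurable (\<pi> \<Otimes>\<^sub>M (lborel \<Otimes>\<^sub>M lborel))" by measurable
qed auto

lemma
  fixes f g :: "real \<Rightarrow> real"
  assumes f: "integrable lborel f" and g: "integrable lborel g"
  shows integrable_joint_survival:
      "integrable lborel (\<lambda>w. f (fst w) * g (snd w) * joint_survival \<pi> w)"
    and integral_joint_survival:
      "(LBINT w. f (fst w) * g (snd w) * joint_survival \<pi> w) =
        (\<integral>z. (LBINT u:{..<fst z}. f u) * (LBINT v:{..<snd z}. g v) \<partial>\<pi>)"
    and integrable_LBINT_lessThan: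
      "integrable \<pi> (\<lambda>z. (LBINT u:{..<fst z}. f u) * (LBINT v:{..<snd z}. g v))"
proof -
  interpret pair_sigma_finite \<pi> "lborel \<Otimes>\<^sub>M lborel :: (real \<times> real) measure" ..
  define k where "k z w = (if fst w < fst z \<and> snd w < snd z then f (fst w) * g (snd w) else 0)"
    for z w :: "real \<times> real"
  have int: "integrable (\<pi> \<Otimes>\<^sub>M (lborel \<Otimes>\<^sub>M lborel)) (case_prod k)"
    unfolding k_def by (rule integrable_quadrant_kernel[OF f g])
  have over_\<pi>: "(\<integral>z. k z w \<partial>\<pi>) = f (fst w) * g (snd w) * joint_survival \<pi> w" for w
  proof -
    have "k z w = f (fst w) * g (snd w) * indicator ({fst w<..} \<times> {snd w<..}) z" for z
      by (cases z) (simp add: k_def indicator_def)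
    then show ?thesis by (simp add: joint_survival_def)
  qed
  have over_lborel: "(\<integral>w. k z w \<partial>(lborel \<Otimes>\<^sub>M lborel)) =
      (LBINT u:{..<fst z}. f u) * (LBINT v:{..<snd z}. g v)" for z
  proof -
    have "k z = (\<lambda>w. indicator ({..<fst z} \<times> {..<snd z}) w *\<^sub>R (f (fst w) * g (snd w)))"
      by (auto simp: k_def indicator_def fun_eq_iff)
    moreover have "set_integrable lborel {..<fst z} f" "set_integrable lborel {..<snd z} g"
      unfolding set_integrable_def by (intro integrable_mult_indicator f g; simp)+
    ultimately show ?thesis
      using set_integral_lborel_Times by (simp only: lborel_prod flip: set_lebesgue_integral_def)
  qed
  show "integrable lborel (\<lambda>w. f (fst w) * g (snd w) * joint_survival \<pi> w)"
    using integrable_snd[OF int] by (simp only: over_\<pi> lborel_prod)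
  show "(LBINT w. f (fst w) * g (snd w) * joint_survival \<pi> w) =
      (\<integral>z. (LBINT u:{..<fst z}. f u) * (LBINT v:{..<snd z}. g v) \<partial>\<pi>)"
    using Fubini_integral[OF int, unfolded over_\<pi> over_lborel] unfolding lborel_prod by simp
  show "integrable \<pi> (\<lambda>z. (LBINT u:{..<fst z}. f u) * (LBINT v:{..<snd z}. g v))"
    using integrable_fst[OF int] by (simp only: over_lborel)
qed

end

locale bounded_marginals = mu: real_distribution \<mu> + nu: real_distribution \<nu>
  for \<mu> \<nu> :: "real measure" +
  fixes a a' b b' :: real
  assumes mu_bounded: "AE x in \<mu>. x \<in> {a..a'}" and nu_bounded: "AE y in \<nu>. y \<in> {b..b'}"
begin

abbreviation "rectangle \<equiv> {a<..<a'} \<times> {b<..<b'}"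

lemma AE_coupling_bounded: "\<pi> \<in> couplings \<mu> \<nu> \<Longrightarrow> AE z in \<pi>. z \<in> {a..a'} \<times> {b..b'}"
  using mu_bounded nu_bounded by (rule AE_coupling_Times[rotated 3]) auto

lemma integrable_coupling:
  fixes h :: "real \<times> real \<Rightarrow> real"
  assumes \<pi>: "\<pi> \<in> couplings \<mu> \<nu>" and h: "continuous_on UNIV h"
  shows "integrable \<pi> h"
proof -
  interpret planar_distribution \<pi> using \<pi> by (rule planar_distribution_coupling)
  have "bounded (h ` ({a..a'} \<times> {b..b'}))"
    by (intro compact_imp_bounded compact_continuous_image compact_Times
        continuous_on_subset[OF h]) auto
  then obtain B where B: "norm (h z) \<le> B" if "z \<in> {a..a'} \<times> {b..b'}" for z
    unfolding bounded_iff by blast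
  show ?thesis
  proof (rule integrable_const_bound)
    show "AE z in \<pi>. norm (h z) \<le> B"
      using AE_coupling_bounded[OF \<pi>] by eventually_elim (rule B)
    show "h \<in> borel_measurable \<pi>"
      using borel_measurable_continuous_onI[OF h]
      by (simp only: measurable_cong_sets[OF sets_eq_borel refl])
  qed
qed

lemma integral_coupling_shift:
  fixes \<phi> \<psi> :: "real \<Rightarrow> real"
  assumes \<pi>: "\<pi> \<in> couplings \<mu> \<nu>" and cont: "continuous_on UNIV \<phi>" "continuous_on UNIV \<psi>"
  shows "(\<integral>z. (\<phi> (fst z) - p) * (\<psi> (snd z) - q) \<partial>\<pi>) =
    (\<integral>z. \<phi> (fst z) * \<psi> (snd z) \<partial>\<pi>) - q * integral\<^sup>L \<mu> \<phi> - p * integral\<^sup>L \<nu> \<psi> + p * q"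
proof -
  interpret planar_distribution \<pi> using \<pi> by (rule planar_distribution_coupling)
  have [simp]: "integrable \<pi> (\<lambda>z. \<phi> (fst z) * \<psi> (snd z))" "integrable \<pi> (\<lambda>z. \<phi> (fst z))"
      "integrable \<pi> (\<lambda>z. \<psi> (snd z))"
    by (auto intro!: integrable_coupling[OF \<pi>] continuous_intros continuous_on_compose2[OF cont(1)]
        continuous_on_compose2[OF cont(2)])
  have "(\<phi> (fst z) - p) * (\<psi> (snd z) - q) =
      \<phi> (fst z) * \<psi> (snd z) - q * \<phi> (fst z) - p * \<psi> (snd z) + p * q" for z
    by (simp add: algebra_simps)
  then show ?thesis
    using integral_fst_coupling[OF \<pi>, of \<phi>] integral_snd_coupling[OF \<pi>, of \<psi>] prob_space
    by (simp add: cont borel_measurable_continuous_onI)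
qed

lemma
  assumes \<pi>: "\<pi> \<in> couplings \<mu> \<nu>"
    and deriv: "\<And>x. (\<phi> has_real_derivative \<phi>' x) (at x)" "\<And>x. (\<psi> has_real_derivative \<psi>' x) (at x)"
    and cont: "continuous_on UNIV \<phi>'" "continuous_on UNIV \<psi>'"
  shows set_integrable_deriv_joint_survival: "set_integrable lborel rectangle
      (\<lambda>w. \<phi>' (fst w) * \<psi>' (snd w) * joint_survival \<pi> w)"
    and set_integral_deriv_joint_survival: "(LBINT w:rectangle.
      \<phi>' (fst w) * \<psi>' (snd w) * joint_survival \<pi> w) =
      (\<integral>z. (\<phi> (fst z) - \<phi> a) * (\<psi> (snd z) - \<psi> b) \<partial>\<pi>)"
proof -
  interpret planar_distribution \<pi> using \<pi> by (rule planar_distribution_coupling)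
  let ?f = "\<lambda>u. indicator {a<..<a'} u * \<phi>' u" and ?g = "\<lambda>v. indicator {b<..<b'} v * \<psi>' v"
  have int: "integrable lborel ?f" "integrable lborel ?g"
    using set_integrable_Ioo[OF continuous_on_subset[OF cont(1)]]
      set_integrable_Ioo[OF continuous_on_subset[OF cont(2)]]
    by (simp_all add: set_integrable_def)
  have ind: "indicator rectangle w *\<^sub>R (\<phi>' (fst w) * \<psi>' (snd w) * joint_survival \<pi> w) =
      ?f (fst w) * ?g (snd w) * joint_survival \<pi> w" for w
    by (cases w) (simp add: indicator_times)
  show "set_integrable lborel rectangle (\<lambda>w. \<phi>' (fst w) * \<psi>' (snd w) * joint_survival \<pi> w)"
    unfolding set_integrable_def ind by (rule integrable_joint_survival[OF int])
  have "(LBINT w:rectangle. \<phi>' (fst w) * \<psi>' (snd w) * joint_survival \<pi> w) =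
      (\<integral>z. (LBINT u:{..<fst z}. ?f u) * (LBINT v:{..<snd z}. ?g v) \<partial>\<pi>)"
    unfolding set_lebesgue_integral_def[of lborel rectangle] ind
    by (rule integral_joint_survival[OF int])
  also have "\<dots> = (\<integral>z. (\<phi> (fst z) - \<phi> a) * (\<psi> (snd z) - \<psi> b) \<partial>\<pi>)"
  proof (rule integral_cong_AE)
    show "AE z in \<pi>. (LBINT u:{..<fst z}. ?f u) * (LBINT v:{..<snd z}. ?g v) =
        (\<phi> (fst z) - \<phi> a) * (\<psi> (snd z) - \<psi> b)"
      using AE_coupling_bounded[OF \<pi>]
      by eventually_elim (auto simp: LBINT_lessThan_indicator_FTC[OF _ cont(1) deriv(1)]
          LBINT_lessThan_indicator_FTC[OF _ cont(2) deriv(2)])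
    have "continuous_on UNIV \<phi>" "continuous_on UNIV \<psi>"
      using deriv by (auto intro!: DERIV_continuous_on intro: DERIV_subset)
    then show "(\<lambda>z. (\<phi> (fst z) - \<phi> a) * (\<psi> (snd z) - \<psi> b)) \<in> borel_measurable \<pi>"
      by (auto dest!: borel_measurable_continuous_onI)
  qed (rule borel_measurable_integrable[OF integrable_LBINT_lessThan[OF int]])
  finally show "(LBINT w:rectangle. \<phi>' (fst w) * \<psi>' (snd w) * joint_survival \<pi> w) =
      (\<integral>z. (\<phi> (fst z) - \<phi> a) * (\<psi> (snd z) - \<psi> b) \<partial>\<pi>)" .
qed

theorem
  assumes \<pi>: "\<pi> \<in> couplings \<mu> \<nu>" and \<pi>': "\<pi>' \<in> couplings \<mu> \<nu>"
    and deriv: "\<And>x. (\<phi> has_real_derivative \<phi>' x) (at x)" "\<And>x. (\<psi> has_real_derivative \<psi>' x) (at x)"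
    and cont: "continuous_on UNIV \<phi>'" "continuous_on UNIV \<psi>'"
  shows hoeffding_set_integrable: "set_integrable lborel rectangle
      (\<lambda>w. \<phi>' (fst w) * \<psi>' (snd w) * (joint_survival \<pi> w - joint_survival \<pi>' w))"
    and hoeffding_identity: "(LBINT w:rectangle.
        \<phi>' (fst w) * \<psi>' (snd w) * (joint_survival \<pi> w - joint_survival \<pi>' w)) =
      (\<integral>z. \<phi> (fst z) * \<psi> (snd z) \<partial>\<pi>) - (\<integral>z. \<phi> (fst z) * \<psi> (snd z) \<partial>\<pi>')"
proof -
  have cont': "continuous_on UNIV \<phi>" "continuous_on UNIV \<psi>"
    using deriv by (auto intro!: DERIV_continuous_on intro: DERIV_subset)
  note int = set_integrable_deriv_joint_survival[OF _ deriv cont]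
  show "set_integrable lborel rectangle
      (\<lambda>w. \<phi>' (fst w) * \<psi>' (snd w) * (joint_survival \<pi> w - joint_survival \<pi>' w))"
    unfolding right_diff_distrib by (intro set_integral_diff(1) int \<pi> \<pi>')
  show "(LBINT w:rectangle. \<phi>' (fst w) * \<psi>' (snd w) * (joint_survival \<pi> w - joint_survival \<pi>' w)) =
      (\<integral>z. \<phi> (fst z) * \<psi> (snd z) \<partial>\<pi>) - (\<integral>z. \<phi> (fst z) * \<psi> (snd z) \<partial>\<pi>')"
    unfolding right_diff_distrib set_integral_diff(2)[OF int[OF \<pi>] int[OF \<pi>']]
    by (simp add: set_integral_deriv_joint_survival[OF _ deriv cont] \<pi> \<pi>'
        integral_coupling_shift cont')
qed

abbreviation "mean_mu \<equiv> integral\<^sup>L \<mu> (\<lambda>x. x)"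
abbreviation "mean_nu \<equiv> integral\<^sup>L \<nu> (\<lambda>y. y)"

definition covariance :: "(real \<times> real) measure \<Rightarrow> real" where
  "covariance \<pi> = (\<integral>z. (fst z - mean_mu) * (snd z - mean_nu) \<partial>\<pi>)"

lemma
  assumes "\<pi> \<in> couplings \<mu> \<nu>" "\<pi>' \<in> couplings \<mu> \<nu>"
  shows set_integrable_joint_survival_diff:
      "set_integrable lborel rectangle (\<lambda>w. joint_survival \<pi> w - joint_survival \<pi>' w)"
    and covariance_diff: "covariance \<pi> - covariance \<pi>' =
      (LBINT w:rectangle. joint_survival \<pi> w - joint_survival \<pi>' w)"
proof -
  have deriv: "((\<lambda>x. x - c) has_real_derivative 1) (at x)" for c x :: real
    by (auto intro!: derivative_eq_intros)
  show "set_integrable lborel rectangle (\<lambda>w. joint_survival \<pi> w - joint_survival \<pi>' w)"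
    using hoeffding_set_integrable[OF assms deriv deriv] by simp
  show "covariance \<pi> - covariance \<pi>' =
      (LBINT w:rectangle. joint_survival \<pi> w - joint_survival \<pi>' w)"
    using hoeffding_identity[OF assms deriv deriv] by (simp add: covariance_def)
qed

lemma comonotone_covariance_unique:
  assumes \<pi>: "\<pi> \<in> couplings \<mu> \<nu>" and \<pi>\<^sub>0: "comonotone_coupling \<mu> \<nu> \<pi>\<^sub>0"
    and eq: "covariance \<pi> = covariance \<pi>\<^sub>0"
  shows "\<pi> = \<pi>\<^sub>0"
proof -
  note \<pi>\<^sub>0' = comonotone_couplingD[OF \<pi>\<^sub>0]
  note le = joint_survival_le_comonotone[OF \<pi> \<pi>\<^sub>0]
  have "joint_survival \<pi>\<^sub>0 (u, v) \<le> joint_survival \<pi> (u, v)" for u v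
  proof -
    interpret enlarged: bounded_marginals \<mu> \<nu> "min a u" "max a' (u + 1)" "min b v" "max b' (v + 1)"
      using mu_bounded nu_bounded by unfold_locales (auto elim: eventually_mono)
    let ?Q = "{min a u<..<max a' (u + 1)} \<times> {min b v<..<max b' (v + 1)}"
    let ?D = "\<lambda>w. indicator ?Q w *\<^sub>R (joint_survival \<pi>\<^sub>0 w - joint_survival \<pi> w)"
    have "integral\<^sup>L lborel ?D = 0"
      using enlarged.covariance_diff[OF \<pi>\<^sub>0' \<pi>] eq by (simp add: set_lebesgue_integral_def)
    moreover have "integrable lborel ?D"
      using enlarged.set_integrable_joint_survival_diff[OF \<pi>\<^sub>0' \<pi>] by (simp add: set_integrable_def)
    ultimately have "AE w in lborel. ?D w = 0"
      using le by (subst (asm) integral_nonneg_eq_0_iff_AE) auto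
    then have "AE w in lborel. w \<in> {u<..<u + 1} \<times> {v<..<v + 1} \<longrightarrow>
        joint_survival \<pi>\<^sub>0 w \<le> joint_survival \<pi> w"
      by eventually_elim (auto simp: indicator_def split: if_splits)
    then show ?thesis
      by (intro joint_survival_le_if_AE_le planar_distribution_coupling[OF \<pi>]
          planar_distribution_coupling[OF \<pi>\<^sub>0']) simp_all
  qed
  then have "joint_survival \<pi> = joint_survival \<pi>\<^sub>0"
    using le by (auto simp: fun_eq_iff intro!: antisym)
  then show ?thesis
    by (rule planar_distribution_eqI_joint_survival[OF planar_distribution_coupling[OF \<pi>]
        planar_distribution_coupling[OF \<pi>\<^sub>0']])
qed

lemma covariance_less_comonotone:
  assumes \<pi>: "\<pi> \<in> couplings \<mu> \<nu>" and \<pi>\<^sub>0: "comonotone_coupling \<mu> \<nu> \<pi>\<^sub>0" and "\<pi> \<noteq> \<pi>\<^sub>0"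
  shows "covariance \<pi> < covariance \<pi>\<^sub>0"
proof -
  have "0 \<le> covariance \<pi>\<^sub>0 - covariance \<pi>"
    unfolding covariance_diff[OF comonotone_couplingD[OF \<pi>\<^sub>0] \<pi>] set_lebesgue_integral_def
    using joint_survival_le_comonotone[OF \<pi> \<pi>\<^sub>0] by (intro Bochner_Integration.integral_nonneg) simp
  moreover have "covariance \<pi> \<noteq> covariance \<pi>\<^sub>0"
    using comonotone_covariance_unique[OF \<pi> \<pi>\<^sub>0] \<open>\<pi> \<noteq> \<pi>\<^sub>0\<close> by blast
  ultimately show ?thesis by simp
qed

end

subsection \<open>The Gromov--Wasserstein cost\<close>

definition distortion :: "real \<times> real \<Rightarrow> real \<times> real \<Rightarrow> real" where
  "distortion z z' = ((fst z - fst z')\<^sup>2 - (snd z - snd z')\<^sup>2)\<^sup>2"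

context planar_distribution
begin

lemma measurable_distortion [measurable]:
  "(\<lambda>q. distortion (fst q) (snd q)) \<in> borel_measurable (\<pi> \<Otimes>\<^sub>M \<pi>)"
  unfolding distortion_def by measurable

lemma gw_cost_eq_nn_integral:
  "gw_cost \<pi> = (\<integral>\<^sup>+ q. ennreal (distortion (fst q) (snd q)) \<partial>(\<pi> \<Otimes>\<^sub>M \<pi>))"
proof -
  have "gw_cost \<pi> = (\<integral>\<^sup>+ z'. \<integral>\<^sup>+ z. ennreal (distortion z' z) \<partial>\<pi> \<partial>\<pi>)"
    by (simp add: gw_cost_def distortion_def case_prod_unfold power2_commute)
  also have "\<dots> = (\<integral>\<^sup>+ q. ennreal (distortion (fst q) (snd q)) \<partial>(\<pi> \<Otimes>\<^sub>M \<pi>))"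
    by (subst nn_integral_fst[symmetric]) auto
  finally show ?thesis .
qed

lemma gw_cost_distr:
  assumes T: "T \<in> borel \<rightarrow>\<^sub>M borel" and isometry: "\<And>z z'. distortion (T z) (T z') = distortion z z'"
  shows "gw_cost (distr \<pi> borel T) = gw_cost \<pi>"
proof -
  interpret T: planar_distribution "distr \<pi> borel T" using T by (rule planar_distribution_distr)
  have [measurable]: "T \<in> \<pi> \<rightarrow>\<^sub>M borel"
    using T by (simp only: measurable_cong_sets[OF sets_eq_borel refl])
  have "distr \<pi> borel T \<Otimes>\<^sub>M distr \<pi> borel T =
      distr (\<pi> \<Otimes>\<^sub>M \<pi>) (borel \<Otimes>\<^sub>M borel) (\<lambda>(z, z'). (T z, T z'))"
    by (rule pair_measure_distr) (simp_all add: T.sigma_finite_measure_axioms)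
  moreover have "(\<lambda>q. distortion (fst q) (snd q)) \<in> borel_measurable (borel \<Otimes>\<^sub>M borel)"
    unfolding distortion_def borel_prod[symmetric] by measurable
  ultimately show ?thesis
    by (simp add: T.gw_cost_eq_nn_integral gw_cost_eq_nn_integral nn_integral_distr
        case_prod_unfold isometry)
qed

end

context bounded_marginals
begin

definition gain :: "(real \<times> real) measure \<Rightarrow> real" where
  "gain \<pi> = (\<integral>z. (fst z - mean_mu)\<^sup>2 * (snd z - mean_nu)\<^sup>2 \<partial>\<pi>) + 2 * (covariance \<pi>)\<^sup>2"

definition marginal_distortion :: real where
  "marginal_distortion =
    2 * (\<integral>x. (x - mean_mu) ^ 4 \<partial>\<mu>) + 2 * (\<integral>y. (y - mean_nu) ^ 4 \<partial>\<nu>) +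
    6 * (\<integral>x. (x - mean_mu)\<^sup>2 \<partial>\<mu>)\<^sup>2 + 6 * (\<integral>y. (y - mean_nu)\<^sup>2 \<partial>\<nu>)\<^sup>2 -
    4 * (\<integral>x. (x - mean_mu)\<^sup>2 \<partial>\<mu>) * (\<integral>y. (y - mean_nu)\<^sup>2 \<partial>\<nu>)"

definition central_moment :: "(real \<times> real) measure \<Rightarrow> nat \<Rightarrow> nat \<Rightarrow> real" where
  "central_moment \<pi> i j = (\<integral>z. (fst z - mean_mu) ^ i * (snd z - mean_nu) ^ j \<partial>\<pi>)"

lemma central_moment_marginal:
  assumes "\<pi> \<in> couplings \<mu> \<nu>"
  shows "central_moment \<pi> i 0 = (\<integral>x. (x - mean_mu) ^ i \<partial>\<mu>)"
    and "central_moment \<pi> 0 j = (\<integral>y. (y - mean_nu) ^ j \<partial>\<nu>)"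
  using integral_fst_coupling[OF assms, of "\<lambda>x. (x - mean_mu) ^ i"]
    integral_snd_coupling[OF assms, of "\<lambda>y. (y - mean_nu) ^ j"]
  by (simp_all add: central_moment_def)

lemma central_moment_degree_le_1:
  assumes \<pi>: "\<pi> \<in> couplings \<mu> \<nu>"
  shows "central_moment \<pi> 0 0 = 1" "central_moment \<pi> 1 0 = 0" "central_moment \<pi> 0 1 = 0"
proof -
  interpret planar_distribution \<pi> using \<pi> by (rule planar_distribution_coupling)
  show "central_moment \<pi> 0 0 = 1" using prob_space by (simp add: central_moment_def)
  have "integrable \<pi> fst" "integrable \<pi> snd"
    by (auto intro!: integrable_coupling[OF \<pi>] continuous_intros)
  then show "central_moment \<pi> 1 0 = 0" "central_moment \<pi> 0 1 = 0"
    using integral_fst_coupling[OF \<pi>, of "\<lambda>x. x"] integral_snd_coupling[OF \<pi>, of "\<lambda>y. y"] prob_space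
    by (simp_all add: central_moment_def)
qed

lemma
  assumes \<pi>: "\<pi> \<in> couplings \<mu> \<nu>"
  shows integrable_distortion: "integrable (\<pi> \<Otimes>\<^sub>M \<pi>) (\<lambda>q. distortion (fst q) (snd q))"
    and integral_distortion:
      "(\<integral>q. distortion (fst q) (snd q) \<partial>(\<pi> \<Otimes>\<^sub>M \<pi>)) = marginal_distortion - 4 * gain \<pi>"
proof -
  interpret planar_distribution \<pi> using \<pi> by (rule planar_distribution_coupling)
  interpret pair_sigma_finite \<pi> \<pi> ..
  let ?M = "central_moment \<pi>"
  define P where "P i j z = (fst z - mean_mu) ^ i * (snd z - mean_nu) ^ j"
    for i j and z :: "real \<times> real"
  have P: "integrable \<pi> (P i j)" "integral\<^sup>L \<pi> (P i j) = ?M i j" for i j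
    unfolding P_def central_moment_def by (auto intro!: integrable_coupling[OF \<pi>] continuous_intros)
  define Q where "Q i j k l q = P i j (fst q) * P k l (snd q)" for i j k l q
  have Q: "integrable (\<pi> \<Otimes>\<^sub>M \<pi>) (Q i j k l)" "integral\<^sup>L (\<pi> \<Otimes>\<^sub>M \<pi>) (Q i j k l) = ?M i j * ?M k l"
    for i j k l
    unfolding Q_def by (simp_all add: integrable_times integral_times P)
  have expand: "distortion (fst q) (snd q) =
      Q 4 0 0 0 q - 4 * Q 3 0 1 0 q + 6 * Q 2 0 2 0 q - 4 * Q 1 0 3 0 q + Q 0 0 4 0 q +
      (Q 0 4 0 0 q - 4 * Q 0 3 0 1 q + 6 * Q 0 2 0 2 q - 4 * Q 0 1 0 3 q + Q 0 0 0 4 q) -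
      2 * (Q 2 2 0 0 q - 2 * Q 2 1 0 1 q + Q 2 0 0 2 q - 2 * Q 1 2 1 0 q + 4 * Q 1 1 1 1 q -
        2 * Q 1 0 1 2 q + Q 0 2 2 0 q - 2 * Q 0 1 2 1 q + Q 0 0 2 2 q)" for q
    unfolding distortion_def Q_def P_def
    by (simp add: power2_eq_square power3_eq_cube power4_eq_xxxx) algebra
  show "integrable (\<pi> \<Otimes>\<^sub>M \<pi>) (\<lambda>q. distortion (fst q) (snd q))"
    unfolding expand by (simp add: Q)
  have "(\<integral>q. distortion (fst q) (snd q) \<partial>(\<pi> \<Otimes>\<^sub>M \<pi>)) =
      2 * ?M 4 0 + 6 * (?M 2 0)\<^sup>2 + 2 * ?M 0 4 + 6 * (?M 0 2)\<^sup>2 -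
      4 * (?M 2 0 * ?M 0 2) - 4 * (?M 2 2 + 2 * (?M 1 1)\<^sup>2)"
    unfolding expand by (simp add: Q central_moment_degree_le_1[OF \<pi>, simplified] power2_eq_square)
  moreover have "gain \<pi> = ?M 2 2 + 2 * (?M 1 1)\<^sup>2"
    by (simp add: gain_def covariance_def central_moment_def)
  ultimately show "(\<integral>q. distortion (fst q) (snd q) \<partial>(\<pi> \<Otimes>\<^sub>M \<pi>)) = marginal_distortion - 4 * gain \<pi>"
    by (simp add: marginal_distortion_def central_moment_marginal[OF \<pi>])
qed

lemma gw_cost_eq_gain:
  assumes \<pi>: "\<pi> \<in> couplings \<mu> \<nu>"
  shows "gw_cost \<pi> = ennreal (marginal_distortion - 4 * gain \<pi>)" "4 * gain \<pi> \<le> marginal_distortion"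
proof -
  interpret planar_distribution \<pi> using \<pi> by (rule planar_distribution_coupling)
  have nonneg: "0 \<le> distortion z z'" for z z' by (simp add: distortion_def)
  show "gw_cost \<pi> = ennreal (marginal_distortion - 4 * gain \<pi>)"
    unfolding gw_cost_eq_nn_integral integral_distortion[OF \<pi>, symmetric]
    by (intro nn_integral_eq_integral integrable_distortion[OF \<pi>]) (simp add: nonneg)
  have "0 \<le> (\<integral>q. distortion (fst q) (snd q) \<partial>(\<pi> \<Otimes>\<^sub>M \<pi>))" by (simp add: nonneg)
  then show "4 * gain \<pi> \<le> marginal_distortion" using integral_distortion[OF \<pi>] by simp
qed

lemma gw_cost_less_iff:
  assumes "\<pi> \<in> couplings \<mu> \<nu>" "\<pi>' \<in> couplings \<mu> \<nu>"
  shows "gw_cost \<pi> < gw_cost \<pi>' \<longleftrightarrow> gain \<pi>' < gain \<pi>"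
  using gw_cost_eq_gain[OF assms(1)] gw_cost_eq_gain[OF assms(2)] by (simp add: ennreal_less_iff)

definition mean_covariance :: "(real \<times> real) measure \<Rightarrow> (real \<times> real) measure \<Rightarrow> real" where
  "mean_covariance \<pi> \<pi>' = (covariance \<pi> + covariance \<pi>') / 2"

definition gain_weight ::
    "(real \<times> real) measure \<Rightarrow> (real \<times> real) measure \<Rightarrow> real \<times> real \<Rightarrow> real" where
  "gain_weight \<pi> \<pi>' w = (fst w - mean_mu) * (snd w - mean_nu) + mean_covariance \<pi> \<pi>'"

lemma
  assumes \<pi>: "\<pi> \<in> couplings \<mu> \<nu>" and \<pi>': "\<pi>' \<in> couplings \<mu> \<nu>"
  shows set_integrable_gain_weight: "set_integrable lborel rectangle
      (\<lambda>w. gain_weight \<pi> \<pi>' w * (joint_survival \<pi> w - joint_survival \<pi>' w))"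
    and gain_diff: "gain \<pi> - gain \<pi>' = 4 * (LBINT w:rectangle.
      gain_weight \<pi> \<pi>' w * (joint_survival \<pi> w - joint_survival \<pi>' w))"
proof -
  let ?D = "\<lambda>w. joint_survival \<pi> w - joint_survival \<pi>' w"
  let ?P = "\<lambda>w. (fst w - mean_mu) * (snd w - mean_nu)"
  have "((\<lambda>x. (x - c)\<^sup>2) has_real_derivative 2 * (x - c)) (at x)" for c x :: real
    by (auto intro!: derivative_eq_intros)
  note deriv = this[of mean_mu] this[of mean_nu]
  have cont: "continuous_on UNIV (\<lambda>x. 2 * (x - c))" for c :: real by (intro continuous_intros)
  have quadruple: "2 * (fst w - mean_mu) * (2 * (snd w - mean_nu)) * ?D w = 4 * (?P w * ?D w)" for w
    by (simp only: mult_ac)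
  note hoeffding = hoeffding_set_integrable[OF \<pi> \<pi>' deriv cont cont, unfolded quadruple]
    hoeffding_identity[OF \<pi> \<pi>' deriv cont cont, unfolded quadruple]
  have int: "set_integrable lborel rectangle (\<lambda>w. ?P w * ?D w)"
    using hoeffding(1) by simp
  have split: "gain_weight \<pi> \<pi>' w * ?D w = ?P w * ?D w + mean_covariance \<pi> \<pi>' * ?D w" for w
    by (simp add: gain_weight_def distrib_right)
  note int_D = set_integrable_mult_right[OF set_integrable_joint_survival_diff[OF \<pi> \<pi>']]
  show "set_integrable lborel rectangle (\<lambda>w. gain_weight \<pi> \<pi>' w * ?D w)"
    unfolding split by (intro set_integral_add(1) int int_D)
  have "(LBINT w:rectangle. gain_weight \<pi> \<pi>' w * ?D w) =
      (LBINT w:rectangle. ?P w * ?D w) + mean_covariance \<pi> \<pi>' * (covariance \<pi> - covariance \<pi>')"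
    unfolding split covariance_diff[OF \<pi> \<pi>'] by (subst set_integral_add(2)[OF int int_D]) simp
  moreover have "4 * (LBINT w:rectangle. ?P w * ?D w) =
      (\<integral>z. (fst z - mean_mu)\<^sup>2 * (snd z - mean_nu)\<^sup>2 \<partial>\<pi>) -
      (\<integral>z. (fst z - mean_mu)\<^sup>2 * (snd z - mean_nu)\<^sup>2 \<partial>\<pi>')"
    using hoeffding(2) by simp
  ultimately show "gain \<pi> - gain \<pi>' = 4 * (LBINT w:rectangle. gain_weight \<pi> \<pi>' w * ?D w)"
    by (simp add: gain_def mean_covariance_def power2_eq_square field_simps)
qed

end

subsection \<open>Distributions with two clusters\<close>

locale two_cluster_distribution = real_distribution M for M :: "real measure" +
  fixes a R K t :: real
  assumes clusters: "AE x in M. x \<in> {a..a + R} \<union> {a + K..a + K + R}"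
    and upper_mass: "measure M {a + R<..} = t"
    and width_pos: "0 < R" and separated: "R < K"
begin

lemma AE_bounded: "AE x in M. x \<in> {a..a + K + R}"
  using clusters by eventually_elim (use width_pos separated in auto)

lemma mean_bounds:
  shows "a + K * t \<le> expectation (\<lambda>x. x)" "expectation (\<lambda>x. x) \<le> a + K * t + R"
proof -
  have int: "integrable M (\<lambda>x. x)"
  proof (rule integrable_const_bound)
    show "AE x in M. norm x \<le> \<bar>a\<bar> + K + R"
      using AE_bounded by eventually_elim (use width_pos separated in auto)
  qed simp
  have cluster: "AE x in M. a + K * indicator {a + R<..} x \<le> x \<and>
      x \<le> a + K * indicator {a + R<..} x + R"
    using clusters by eventually_elim (use width_pos separated in \<open>auto simp: indicator_def\<close>)
  have [simp]: "integrable M (indicator {a + R<..} :: real \<Rightarrow> real)"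
    by (simp add: emeasure_eq_measure)
  have base: "expectation (\<lambda>x. a + K * indicator {a + R<..} x) = a + K * t"
    using prob_space by (simp add: upper_mass)
  show "a + K * t \<le> expectation (\<lambda>x. x)"
    unfolding base[symmetric] by (rule integral_mono_AE) (use int cluster in auto)
  have "expectation (\<lambda>x. x) \<le> expectation (\<lambda>x. a + K * indicator {a + R<..} x + R)"
    by (rule integral_mono_AE) (use int cluster in auto)
  also have "\<dots> = a + K * t + R" using prob_space by (simp add: upper_mass)
  finally show "expectation (\<lambda>x. x) \<le> a + K * t + R" .
qed

lemma AE_deviation_le:
  "AE x in M. \<bar>x - expectation (\<lambda>x. x) - K * (indicator {a + R<..} x - t)\<bar> \<le> R"
  using clusters
  by eventually_elim
    (use mean_bounds width_pos separated in \<open>auto simp: indicator_def algebra_simps abs_le_iff\<close>)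

lemma mass_bounds: "0 \<le> t" "t \<le> 1"
  using upper_mass prob_le_1[of "{a + R<..}"] measure_nonneg[of M "{a + R<..}"] by simp_all

lemma two_cluster_distribution_uminus:
  "two_cluster_distribution (distr M borel uminus) (- (a + K + R)) R K (1 - t)"
proof (intro two_cluster_distribution.intro two_cluster_distribution_axioms.intro)
  let ?b = "- (a + K + R)"
  show "real_distribution (distr M borel uminus)" by (rule real_distribution_distr) simp
  have "AE x in M. - x \<in> {?b..?b + R} \<union> {?b + K..?b + K + R}"
    using clusters by eventually_elim auto
  then show "AE y in distr M borel uminus. y \<in> {?b..?b + R} \<union> {?b + K..?b + K + R}"
    by (subst AE_distr_iff) auto
  have "measure (distr M borel uminus) {?b + R<..} = prob (uminus -` {?b + R<..})"
    by (simp add: measure_distr)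
  also have "\<dots> = prob (space M - {a + R<..})"
  proof (rule finite_measure_eq_AE)
    show "AE x in M. (x \<in> uminus -` {?b + R<..}) = (x \<in> space M - {a + R<..})"
      using clusters by eventually_elim (use separated in auto)
  qed (auto intro: measurable_sets_borel[of uminus borel])
  also have "\<dots> = 1 - t" by (subst prob_compl) (auto simp: upper_mass)
  finally show "measure (distr M borel uminus) {?b + R<..} = 1 - t" .
qed (rule width_pos separated)+

end

lemma two_cluster_distribution_mixture:
  fixes M N :: "real measure"
  assumes M: "real_distribution M" "AE x in M. x \<in> {a..a + R}"
    and N: "real_distribution N" "AE x in N. x \<in> {a..a + R}"
    and "0 < R" "R < K" and t: "0 \<le> t" "t \<le> 1"
  shows "two_cluster_distribution (mixture t M (distr N borel (\<lambda>x. x + K))) a R K t"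
proof (intro two_cluster_distribution.intro two_cluster_distribution_axioms.intro)
  let ?\<mu> = "mixture t M (distr N borel (\<lambda>x. x + K))"
  interpret M: real_distribution M by fact
  interpret N: real_distribution N by fact
  have "real_distribution (distr N borel (\<lambda>x. x + K))" by (rule N.real_distribution_distr) simp
  then show "real_distribution ?\<mu>" using M t by (intro real_distribution_mixture)
  have emeasure: "emeasure ?\<mu> B =
      ennreal (1 - t) * emeasure M B + ennreal t * emeasure N ((\<lambda>x. x + K) -` B)"
    and shift: "(\<lambda>x. x + K) -` B \<in> sets borel" if "B \<in> sets borel" for B
    using that measurable_sets_borel[of "\<lambda>x. x + K" borel B]
    by (simp_all add: emeasure_mixture emeasure_distr)
  have null: "emeasure L B = 0"
    if "AE x in L. x \<in> {a..a + R}" "B \<in> sets L" "B \<inter> {a..a + R} = {}" for L :: "real measure" and B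
  proof -
    have "AE x in L. x \<notin> B" using that(1) by eventually_elim (use that(3) in blast)
    then show ?thesis using AE_iff_null_sets[OF that(2)] by auto
  qed
  let ?S = "- ({a..a + R} \<union> {a + K..a + K + R})"
  have "emeasure M ?S = 0" "emeasure N ((\<lambda>x. x + K) -` ?S) = 0"
    by (rule null[OF M(2)] null[OF N(2)]; auto intro!: shift simp del: vimage_Compl)+
  then have "emeasure ?\<mu> ?S = 0" by (subst emeasure) auto
  then show "AE x in ?\<mu>. x \<in> {a..a + R} \<union> {a + K..a + K + R}"
    by (intro AE_I[of _ _ ?S]) auto
  have "emeasure M {a + R<..} = 0" by (rule null[OF M(2)]) auto
  moreover have "emeasure N ((\<lambda>x. x + K) -` {a + R<..}) = 1"
  proof (rule N.emeasure_eq_1_AE)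
    show "AE x in N. x \<in> (\<lambda>x. x + K) -` {a + R<..}"
      using N(2) by eventually_elim (use \<open>R < K\<close> in auto)
  qed (simp add: shift)
  ultimately show "measure ?\<mu> {a + R<..} = t" using t by (simp add: measure_def emeasure)
qed fact+

locale two_clusters =
  mu: two_cluster_distribution \<mu> a R K t + nu: two_cluster_distribution \<nu> b R K t
  for \<mu> \<nu> :: "real measure" and a b R K t :: real
begin

sublocale bounded_marginals \<mu> \<nu> a "a + K + R" b "b + K + R"
  using mu.AE_bounded nu.AE_bounded by unfold_locales

lemma AE_coupling_clusters:
  assumes "\<pi> \<in> couplings \<mu> \<nu>"
  shows "AE z in \<pi>. z \<in> ({a..a + R} \<union> {a + K..a + K + R}) \<times> ({b..b + R} \<union> {b + K..b + K + R})"
  by (rule AE_coupling_Times[OF assms _ _ mu.clusters nu.clusters]) auto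

definition cross_mass :: "(real \<times> real) measure \<Rightarrow> real" where
  "cross_mass \<pi> = measure \<pi> ({..a + R} \<times> {b + R<..})"

lemma
  assumes "\<pi> \<in> couplings \<mu> \<nu>"
  shows joint_survival_cluster_ends: "joint_survival \<pi> (a + R, b + R) = t - cross_mass \<pi>"
    and cross_mass_eq_downward: "cross_mass \<pi> = measure \<pi> ({a + R<..} \<times> {..b + R})"
  unfolding cross_mass_def joint_survival_def
  using measure_fst_coupling[OF assms, of "{a + R<..}" "{b + R<..}", unfolded mu.upper_mass]
    measure_snd_coupling[OF assms, of "{a + R<..}" "{b + R<..}", unfolded nu.upper_mass]
  by simp_all

lemma cross_mass_bounds:
  assumes \<pi>: "\<pi> \<in> couplings \<mu> \<nu>"
  shows "0 \<le> cross_mass \<pi>" "cross_mass \<pi> \<le> t" "cross_mass \<pi> \<le> 1 - t"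
proof -
  show "0 \<le> cross_mass \<pi>" by (simp add: cross_mass_def)
  show "cross_mass \<pi> \<le> t"
    using joint_survival_cluster_ends[OF \<pi>] measure_nonneg[of \<pi>]
    by (metis diff_ge_0_iff_ge joint_survival_def)
  have "measure \<mu> {..a + R} = 1 - t"
    using mu.prob_compl[of "{a + R<..}"] mu.upper_mass by (simp flip: Compl_eq_Diff_UNIV)
  then have "1 - t = cross_mass \<pi> + measure \<pi> ({..a + R} \<times> {..b + R})"
    using measure_fst_coupling[OF \<pi>, of "{..a + R}" "{b + R<..}"] by (simp add: cross_mass_def)
  then show "cross_mass \<pi> \<le> 1 - t"
    using measure_nonneg[of \<pi> "{..a + R} \<times> {..b + R}"] by linarith
qed

lemma cross_mass_comonotone: "comonotone_coupling \<mu> \<nu> \<pi> \<Longrightarrow> cross_mass \<pi> = 0"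
  using joint_survival_cluster_ends[of \<pi>]
  by (simp add: comonotone_coupling_def mu.upper_mass nu.upper_mass)

lemma joint_survival_between_clusters:
  assumes \<pi>: "\<pi> \<in> couplings \<mu> \<nu>"
    and w: "w \<in> {a + R..<a + K} \<times> {b + R..<b + K}"
  shows "joint_survival \<pi> w = t - cross_mass \<pi>"
proof -
  interpret planar_distribution \<pi> using \<pi> by (rule planar_distribution_coupling)
  have "prob ({fst w<..} \<times> {snd w<..}) = prob ({a + R<..} \<times> {b + R<..})"
  proof (rule finite_measure_eq_AE)
    show "AE z in \<pi>. (z \<in> {fst w<..} \<times> {snd w<..}) = (z \<in> {a + R<..} \<times> {b + R<..})"
      using AE_coupling_clusters[OF \<pi>] by eventually_elim (use w in \<open>auto simp: mem_Times_iff\<close>)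
  qed auto
  then show ?thesis
    using joint_survival_cluster_ends[OF \<pi>] by (simp add: joint_survival_def)
qed

lemma joint_survival_diff_le_cross_mass:
  assumes \<pi>: "\<pi> \<in> couplings \<mu> \<nu>" and \<pi>\<^sub>0: "comonotone_coupling \<mu> \<nu> \<pi>\<^sub>0"
    and "u < a + K \<and> b + R \<le> v \<or> a + R \<le> u \<and> v < b + K"
  shows "joint_survival \<pi>\<^sub>0 (u, v) - joint_survival \<pi> (u, v) \<le> cross_mass \<pi>"
proof -
  interpret planar_distribution \<pi> using \<pi> by (rule planar_distribution_coupling)
  note clusters = AE_coupling_clusters[OF \<pi>]
  have le_lower: "joint_survival \<pi>\<^sub>0 (u, v) - joint_survival \<pi> (u, v) \<le> prob ({..u} \<times> {v<..})"
    and le_upper: "joint_survival \<pi>\<^sub>0 (u, v) - joint_survival \<pi> (u, v) \<le> prob ({u<..} \<times> {..v})"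
    using measure_snd_coupling[OF \<pi>, of "{u<..}" "{v<..}"]
      measure_fst_coupling[OF \<pi>, of "{u<..}" "{v<..}"] \<pi>\<^sub>0
    by (simp_all add: comonotone_coupling_def joint_survival_def Compl_greaterThan)
  from assms(3) show ?thesis
  proof
    assume uv: "u < a + K \<and> b + R \<le> v"
    have "prob ({..u} \<times> {v<..}) \<le> prob ({..a + R} \<times> {b + R<..})"
      using clusters
      by (intro finite_measure_mono_AE) (auto elim!: eventually_mono, use uv in auto)
    with le_lower show ?thesis unfolding cross_mass_def by linarith
  next
    assume uv: "a + R \<le> u \<and> v < b + K"
    have "prob ({u<..} \<times> {..v}) \<le> prob ({a + R<..} \<times> {..b + R})"
      using clusters
      by (intro finite_measure_mono_AE) (auto elim!: eventually_mono, use uv in auto)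
    with le_upper show ?thesis unfolding cross_mass_eq_downward[OF \<pi>] by linarith
  qed
qed

end

lemma perturbed_product_ge:
  fixes \<alpha> \<beta> d e K R :: real
  assumes "\<bar>\<alpha>\<bar> \<le> 1" "\<bar>\<beta>\<bar> \<le> 1" "\<bar>d\<bar> \<le> R" "\<bar>e\<bar> \<le> R" "0 \<le> K"
  shows "K\<^sup>2 * (\<alpha> * \<beta>) - 2 * K * R - R\<^sup>2 \<le> (K * \<alpha> + d) * (K * \<beta> + e)"
proof -
  have "\<bar>\<alpha> * e\<bar> \<le> 1 * R" "\<bar>\<beta> * d\<bar> \<le> 1 * R" "\<bar>d * e\<bar> \<le> R * R"
    unfolding abs_mult using assms by (intro mult_mono; linarith)+
  then have "- R \<le> \<alpha> * e" "- R \<le> \<beta> * d" and de: "- (R * R) \<le> d * e" by linarith+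
  then have "K * (- R) \<le> K * (\<alpha> * e)" "K * (- R) \<le> K * (\<beta> * d)"
    using \<open>0 \<le> K\<close> by (intro mult_left_mono; simp)+
  with de show ?thesis by (simp add: power2_eq_square algebra_simps)
qed

context two_clusters
begin

lemma AE_coupling_deviation_le:
  assumes \<pi>: "\<pi> \<in> couplings \<mu> \<nu>"
  shows "AE z in \<pi>. \<bar>fst z - mean_mu - K * (indicator {a + R<..} (fst z) - t)\<bar> \<le> R \<and>
    \<bar>snd z - mean_nu - K * (indicator {b + R<..} (snd z) - t)\<bar> \<le> R"
proof -
  have "AE z in \<pi>. z \<in> {x. \<bar>x - mean_mu - K * (indicator {a + R<..} x - t)\<bar> \<le> R} \<times>
      {y. \<bar>y - mean_nu - K * (indicator {b + R<..} y - t)\<bar> \<le> R}"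
    by (rule AE_coupling_Times[OF \<pi>]) (use mu.AE_deviation_le nu.AE_deviation_le in simp_all)
  then show ?thesis by eventually_elim auto
qed

lemma
  assumes \<pi>: "\<pi> \<in> couplings \<mu> \<nu>"
  defines "\<alpha> \<equiv> \<lambda>z. indicator {a + R<..} (fst z) - t" and "\<beta> \<equiv> \<lambda>z. indicator {b + R<..} (snd z) - t"
  shows integrable_upper_indicators: "integrable \<pi> (\<lambda>z. \<alpha> z * \<beta> z)"
    and integral_upper_indicators: "(\<integral>z. \<alpha> z * \<beta> z \<partial>\<pi>) = t - t\<^sup>2 - cross_mass \<pi>"
proof -
  interpret planar_distribution \<pi> using \<pi> by (rule planar_distribution_coupling)
  have expand: "\<alpha> z * \<beta> z = indicator ({a + R<..} \<times> {b + R<..}) z -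
      t * indicator {a + R<..} (fst z) - t * indicator {b + R<..} (snd z) + t\<^sup>2" for z
    by (cases z) (simp add: \<alpha>_def \<beta>_def indicator_times power2_eq_square algebra_simps)
  have [simp]: "integrable \<pi> (\<lambda>z. indicator {a + R<..} (fst z) :: real)"
    "integrable \<pi> (\<lambda>z. indicator {b + R<..} (snd z) :: real)"
    by (auto intro!: integrable_const_bound[where B = 1])
  have [simp]: "integrable \<pi> (indicator ({a + R<..} \<times> {b + R<..}) :: _ \<Rightarrow> real)"
    by (simp add: emeasure_eq_measure)
  show "integrable \<pi> (\<lambda>z. \<alpha> z * \<beta> z)" unfolding expand by simp
  show "(\<integral>z. \<alpha> z * \<beta> z \<partial>\<pi>) = t - t\<^sup>2 - cross_mass \<pi>"
    unfolding expand using prob_space integral_fst_coupling[OF \<pi>, of "indicator {a + R<..}"]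
      integral_snd_coupling[OF \<pi>, of "indicator {b + R<..}"] joint_survival_cluster_ends[OF \<pi>]
    by (simp add: mu.upper_mass nu.upper_mass joint_survival_def power2_eq_square)
qed

lemma covariance_ge:
  assumes \<pi>: "\<pi> \<in> couplings \<mu> \<nu>"
  shows "K\<^sup>2 * (t - t\<^sup>2 - cross_mass \<pi>) - 2 * K * R - R\<^sup>2 \<le> covariance \<pi>"
proof -
  interpret planar_distribution \<pi> using \<pi> by (rule planar_distribution_coupling)
  let ?\<alpha> = "\<lambda>z. indicator {a + R<..} (fst z) - t" and ?\<beta> = "\<lambda>z. indicator {b + R<..} (snd z) - t"
  have "K\<^sup>2 * (t - t\<^sup>2 - cross_mass \<pi>) - 2 * K * R - R\<^sup>2 =
      expectation (\<lambda>z. K\<^sup>2 * (?\<alpha> z * ?\<beta> z) - 2 * K * R - R\<^sup>2)"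
    using integrable_upper_indicators[OF \<pi>] prob_space
    by (simp add: integral_upper_indicators[OF \<pi>])
  also have "\<dots> \<le> covariance \<pi>"
    unfolding covariance_def
  proof (rule integral_mono_AE)
    show "AE z in \<pi>. K\<^sup>2 * (?\<alpha> z * ?\<beta> z) - 2 * K * R - R\<^sup>2 \<le> (fst z - mean_mu) * (snd z - mean_nu)"
      using AE_coupling_deviation_le[OF \<pi>]
    proof eventually_elim
      case (elim z)
      moreover have "\<bar>?\<alpha> z\<bar> \<le> 1" "\<bar>?\<beta> z\<bar> \<le> 1"
        using mu.mass_bounds by (auto simp: indicator_def)
      ultimately show ?case
        using perturbed_product_ge[of "?\<alpha> z" "?\<beta> z" "fst z - mean_mu - K * ?\<alpha> z" R
            "snd z - mean_nu - K * ?\<beta> z" K] mu.width_pos mu.separated by simp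
    qed
    show "integrable \<pi> (\<lambda>z. K\<^sup>2 * (?\<alpha> z * ?\<beta> z) - 2 * K * R - R\<^sup>2)"
      using integrable_upper_indicators[OF \<pi>] by simp
    show "integrable \<pi> (\<lambda>z. (fst z - mean_mu) * (snd z - mean_nu))"
      by (intro integrable_coupling[OF \<pi>] continuous_intros)
  qed
  finally show ?thesis .
qed

end

subsection \<open>Comparison with the comonotone coupling\<close>

text \<open>
  The constant \<open>50\<close> makes the integral of the weight over the gap exceed the error term \<open>4 K R W\<close>,
  where \<open>4 K R\<close> is the difference of the areas of the rectangle and of the gap.
\<close>

locale comonotone_comparison = two_clusters +
  fixes \<pi> \<pi>\<^sub>0 :: "(real \<times> real) measure" and \<kappa> :: real
  assumes coupling: "\<pi> \<in> couplings \<mu> \<nu>" and comonotone: "comonotone_coupling \<mu> \<nu> \<pi>\<^sub>0"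
    and margin_le_masses: "\<kappa> \<le> t" "\<kappa> \<le> 1 - t"
    and margin_le_cross: "\<kappa> \<le> 1 / 4 - cross_mass \<pi> / 2"
    and far_apart: "50 * R \<le> K * \<kappa>"
begin

abbreviation "gap \<equiv> {a + R<..<a + K} \<times> {b + R<..<b + K}"
abbreviation "p \<equiv> cross_mass \<pi>"
abbreviation "s \<equiv> mean_covariance \<pi>\<^sub>0 \<pi>"
abbreviation "weight \<equiv> gain_weight \<pi>\<^sub>0 \<pi>"
abbreviation "deficit \<equiv> \<lambda>w. joint_survival \<pi>\<^sub>0 w - joint_survival \<pi> w"
abbreviation "W \<equiv> 3 * (K + R)\<^sup>2"

lemmas comonotone_in_couplings = comonotone_couplingD[OF comonotone]
lemmas p_bounds = cross_mass_bounds[OF coupling]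

lemma K_pos: "0 < K" using mu.width_pos mu.separated by linarith

lemma width_le: "200 * R \<le> K"
proof -
  have "K * \<kappa> \<le> K * (1 / 4)" using margin_le_cross p_bounds(1) K_pos by (intro mult_left_mono) auto
  with far_apart show ?thesis by simp
qed

lemma scale_bounds:
  shows "0 < R * R" "200 * (R * R) \<le> K * R" "200 * (K * R) \<le> K * K" "50 * (K * R) \<le> K * K * \<kappa>"
  using mult_right_mono[OF width_le, of R] mult_left_mono[OF width_le, of K]
    mult_left_mono[OF far_apart, of K] mu.width_pos K_pos by simp_all

lemma mean_covariance_ge:
  "K\<^sup>2 * (t - t\<^sup>2 - p / 2) - 2 * K * R - R\<^sup>2 \<le> s"
  using covariance_ge[OF coupling] covariance_ge[OF comonotone_in_couplings]
  by (simp add: mean_covariance_def cross_mass_comonotone[OF comonotone] algebra_simps)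

lemma weight_ge_in_corner:
  assumes \<tau>: "\<tau> = t \<or> \<tau> = 1 - t"
    and corner: "(K * \<tau> - R)\<^sup>2 \<le> (fst w - mean_mu) * (snd w - mean_nu)"
  shows "R\<^sup>2 \<le> weight w"
proof -
  have "p \<le> \<tau>" "\<kappa> \<le> \<tau>" "\<tau> \<le> 1"
    using \<tau> p_bounds margin_le_masses mu.mass_bounds by auto
  moreover have "\<tau>\<^sup>2 + (t - t\<^sup>2) = \<tau>"
    using \<tau> by (auto simp: power2_eq_square left_diff_distrib right_diff_distrib)
  ultimately have "K * K * (\<kappa> / 2) \<le> K * K * (\<tau>\<^sup>2 + (t - t\<^sup>2) - p / 2)" "K * R * \<tau> \<le> K * R * 1"
    using K_pos mu.width_pos by (intro mult_left_mono; simp)+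
  with corner mean_covariance_ge scale_bounds show ?thesis
    by (simp add: gain_weight_def power2_eq_square algebra_simps)
qed

lemma weight_ge_lower_corner:
  assumes "fst w \<le> a + R" "snd w \<le> b + R"
  shows "R\<^sup>2 \<le> weight w"
proof (rule weight_ge_in_corner)
  have "K * \<kappa> \<le> K * t" using margin_le_masses K_pos by simp
  then have "(K * t - R) * (K * t - R) \<le> (mean_mu - fst w) * (mean_nu - snd w)"
    using assms mu.mean_bounds nu.mean_bounds far_apart mu.width_pos by (intro mult_mono) auto
  then show "(K * t - R)\<^sup>2 \<le> (fst w - mean_mu) * (snd w - mean_nu)"
    by (simp add: power2_eq_square algebra_simps)
qed simp

lemma weight_ge_upper_corner:
  assumes "a + K \<le> fst w" "b + K \<le> snd w"
  shows "R\<^sup>2 \<le> weight w"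
proof (rule weight_ge_in_corner)
  have "K * \<kappa> \<le> K * (1 - t)" using margin_le_masses K_pos by simp
  then have "(K * (1 - t) - R) * (K * (1 - t) - R) \<le> (fst w - mean_mu) * (snd w - mean_nu)"
    using assms mu.mean_bounds nu.mean_bounds far_apart mu.width_pos
    by (intro mult_mono) (auto simp: algebra_simps)
  then show "(K * (1 - t) - R)\<^sup>2 \<le> (fst w - mean_mu) * (snd w - mean_nu)"
    by (simp add: power2_eq_square)
qed simp

lemma weight_ge:
  assumes "w \<in> rectangle"
  shows "- W \<le> weight w - R\<^sup>2"
proof -
  have "0 \<le> K * t" "K * t \<le> K" using mu.mass_bounds K_pos by (auto simp: mult_le_cancel_left1)
  then have "\<bar>fst w - mean_mu\<bar> \<le> K + R" "\<bar>snd w - mean_nu\<bar> \<le> K + R"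
    using assms mu.mean_bounds nu.mean_bounds by auto
  then have "\<bar>(fst w - mean_mu) * (snd w - mean_nu)\<bar> \<le> (K + R) * (K + R)"
    unfolding abs_mult by (intro mult_mono) auto
  then have "- ((K + R) * (K + R)) \<le> (fst w - mean_mu) * (snd w - mean_nu)" by linarith
  moreover have "K\<^sup>2 * (- 1) \<le> K\<^sup>2 * (t - t\<^sup>2 - p / 2)"
  proof (rule mult_left_mono)
    have "t\<^sup>2 \<le> t" using mu.mass_bounds by (simp add: power2_eq_square mult_left_le)
    then show "- 1 \<le> t - t\<^sup>2 - p / 2" using p_bounds mu.mass_bounds by linarith
  qed simp
  ultimately show ?thesis
    using mean_covariance_ge scale_bounds
    by (simp add: gain_weight_def power2_eq_square algebra_simps)
qed

lemma weighted_deficit_ge: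
  assumes w: "w \<in> rectangle"
  shows "p * (indicator gap w * (weight w - R\<^sup>2 + W) - W) \<le>
    (weight w - R\<^sup>2) * deficit w"
proof (cases "w \<in> gap")
  case True
  then have "w \<in> {a + R..<a + K} \<times> {b + R..<b + K}" by auto
  then have "deficit w = p"
    by (simp add: joint_survival_between_clusters coupling comonotone_in_couplings
        cross_mass_comonotone[OF comonotone])
  with True show ?thesis by (simp add: algebra_simps)
next
  case False
  have deficit: "0 \<le> deficit w"
    using joint_survival_le_comonotone[OF coupling comonotone] by simp
  have W: "0 \<le> W" by simp
  consider (corner) "fst w \<le> a + R \<and> snd w \<le> b + R \<or> a + K \<le> fst w \<and> b + K \<le> snd w"
    | (off_corner) "fst w < a + K \<and> b + R \<le> snd w \<or> a + R \<le> fst w \<and> snd w < b + K"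
    using mu.separated by linarith
  then have "- (W * p) \<le> (weight w - R\<^sup>2) * deficit w"
  proof cases
    case corner
    then have "R\<^sup>2 \<le> weight w" using weight_ge_lower_corner weight_ge_upper_corner by blast
    then have "0 \<le> (weight w - R\<^sup>2) * deficit w" using deficit by simp
    moreover have "0 \<le> W * p" using W p_bounds(1) by simp
    ultimately show ?thesis by linarith
  next
    case off_corner
    then have "W * deficit w \<le> W * p"
      using joint_survival_diff_le_cross_mass[OF coupling comonotone off_corner] W
      by (intro mult_left_mono) auto
    moreover have "- W * deficit w \<le> (weight w - R\<^sup>2) * deficit w"
      using weight_ge[OF w] deficit by (rule mult_right_mono)
    ultimately show ?thesis by simp
  qed
  with False show ?thesis by (simp add: mult.commute)
qed

lemma weight_at_gap_centre_ge:
  "40 * (K * R) + R\<^sup>2 \<le>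
    (((a + R) + (a + K)) / 2 - mean_mu) * (((b + R) + (b + K)) / 2 - mean_nu) + s"
proof -
  let ?x = "((a + R) + (a + K)) / 2 - mean_mu" and ?y = "((b + R) + (b + K)) / 2 - mean_nu"
  have "\<bar>?x - K * (1 / 2 - t)\<bar> \<le> R" "\<bar>?y - K * (1 / 2 - t)\<bar> \<le> R"
    using mu.mean_bounds nu.mean_bounds mu.width_pos by (auto simp: abs_le_iff field_simps)
  moreover have "\<bar>1 / 2 - t\<bar> \<le> 1" using mu.mass_bounds by auto
  ultimately have "K\<^sup>2 * ((1 / 2 - t) * (1 / 2 - t)) - 2 * K * R - R\<^sup>2 \<le> ?x * ?y"
    using perturbed_product_ge[of "1 / 2 - t" "1 / 2 - t" "?x - K * (1 / 2 - t)" R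
        "?y - K * (1 / 2 - t)" K]
      K_pos by simp
  moreover have "K\<^sup>2 * ((1 / 2 - t) * (1 / 2 - t)) + K\<^sup>2 * (t - t\<^sup>2 - p / 2) =
      K\<^sup>2 * (1 / 4 - p / 2)"
    by (simp add: power2_eq_square algebra_simps)
  moreover have "K\<^sup>2 * \<kappa> \<le> K\<^sup>2 * (1 / 4 - p / 2)"
    using margin_le_cross by (intro mult_left_mono) auto
  ultimately show ?thesis
    using mean_covariance_ge scale_bounds by (simp add: power2_eq_square)
qed

lemma gap_dominates:
  "W * (K + R)\<^sup>2 \<le> (LBINT w:gap. weight w - R\<^sup>2 + W)"
proof -
  define c where "c = (((a + R) + (a + K)) / 2 - mean_mu) * (((b + R) + (b + K)) / 2 - mean_nu) +
    s - R\<^sup>2"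
  have "W \<le> 4 * (K * K)" and half: "K * K / 2 \<le> (K - R)\<^sup>2"
    using scale_bounds by (simp_all add: power2_eq_square algebra_simps)
  then have "W * (4 * (K * R)) \<le> 4 * (K * K) * (4 * (K * R))"
    using K_pos mu.width_pos by (intro mult_right_mono) auto
  also have "\<dots> \<le> K * K / 2 * (40 * (K * R))" using K_pos mu.width_pos by simp
  also have "\<dots> \<le> (K - R)\<^sup>2 * c"
    using half weight_at_gap_centre_ge K_pos mu.width_pos by (intro mult_mono) (auto simp: c_def)
  finally have "W * (K + R)\<^sup>2 \<le> (K - R)\<^sup>2 * (c + W)" by (simp add: power2_eq_square algebra_simps)
  also have "\<dots> = (LBINT w:gap. weight w - R\<^sup>2 + W)"
    using set_integral_bilinear[of "a + R" "a + K" "b + R" "b + K" mean_mu mean_nu "s - R\<^sup>2 + W"]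
      mu.separated
    by (simp add: gain_weight_def c_def power2_eq_square algebra_simps)
  finally show ?thesis .
qed

text \<open>
  Integrating \<open>weight w - R\<^sup>2\<close> instead of the weight itself leaves a multiple of the covariance
  difference, which is positive even if no mass crosses between the clusters.
\<close>

theorem gain_diff_ge: "4 * R\<^sup>2 * (covariance \<pi>\<^sub>0 - covariance \<pi>) \<le> gain \<pi>\<^sub>0 - gain \<pi>"
proof -
  have int_gap: "set_integrable lborel gap (\<lambda>w. weight w - R\<^sup>2 + W)"
    using set_integrable_bilinear[of "a + R" "a + K" "b + R" "b + K" mean_mu mean_nu "s - R\<^sup>2 + W"]
      mu.separated
    by (simp add: gain_weight_def algebra_simps)
  have measure: "measure lborel rectangle = (K + R)\<^sup>2"
    using mu.width_pos K_pos by (simp add: measure_lborel_Ioo_Times power2_eq_square)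
  have "gap \<subseteq> rectangle" using mu.width_pos by auto
  note lower = set_integrable_indicator_minus_const[OF fmeasurable_lborel_Ioo_Times
      fmeasurableD[OF fmeasurable_lborel_Ioo_Times] this int_gap, of W]
    set_integral_indicator_minus_const[OF fmeasurable_lborel_Ioo_Times
      fmeasurableD[OF fmeasurable_lborel_Ioo_Times] this int_gap, of W]
  have int_weight: "set_integrable lborel rectangle (\<lambda>w. weight w * deficit w)"
    using set_integrable_gain_weight[OF comonotone_in_couplings coupling] .
  have int_deficit: "set_integrable lborel rectangle deficit"
    using set_integrable_joint_survival_diff[OF comonotone_in_couplings coupling] .
  have "0 \<le> p * ((LBINT w:gap. weight w - R\<^sup>2 + W) - W * (K + R)\<^sup>2)"
    using gap_dominates p_bounds(1) by simp
  also have "\<dots> = (LBINT w:rectangle. p * (indicator gap w * (weight w - R\<^sup>2 + W) - W))"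
    using mu.width_pos K_pos by (simp add: lower(2) measure)
  also have "\<dots> \<le> (LBINT w:rectangle. (weight w - R\<^sup>2) * deficit w)"
  proof (rule set_integral_mono)
    show "set_integrable lborel rectangle (\<lambda>w. (weight w - R\<^sup>2) * deficit w)"
      unfolding left_diff_distrib
      by (intro set_integral_diff(1) set_integrable_mult_right int_weight int_deficit)
  qed (use lower(1) weighted_deficit_ge in auto)
  also have "\<dots> = (gain \<pi>\<^sub>0 - gain \<pi>) / 4 - R\<^sup>2 * (covariance \<pi>\<^sub>0 - covariance \<pi>)"
    using gain_diff[OF comonotone_in_couplings coupling]
      covariance_diff[OF comonotone_in_couplings coupling]
      set_integral_diff(2)[OF int_weight set_integrable_mult_right[OF int_deficit], of "R\<^sup>2"]
    by (simp add: left_diff_distrib)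
  finally show ?thesis by simp
qed

end

context two_clusters
begin

theorem comonotone_cost_less:
  assumes "\<pi> \<in> couplings \<mu> \<nu>" "comonotone_coupling \<mu> \<nu> \<pi>\<^sub>0" "\<pi> \<noteq> \<pi>\<^sub>0"
    and "\<kappa> \<le> t" "\<kappa> \<le> 1 - t" "\<kappa> \<le> 1 / 4 - cross_mass \<pi> / 2" "50 * R \<le> K * \<kappa>"
  shows "gw_cost \<pi>\<^sub>0 < gw_cost \<pi>"
proof -
  interpret comonotone_comparison \<mu> \<nu> a b R K t \<pi> \<pi>\<^sub>0 \<kappa>
    using assms by unfold_locales
  have "0 < 4 * R\<^sup>2 * (covariance \<pi>\<^sub>0 - covariance \<pi>)"
    using covariance_less_comonotone[OF assms(1-3)] mu.width_pos by simp
  also note gain_diff_ge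
  finally show ?thesis by (simp add: gw_cost_less_iff comonotone_in_couplings coupling)
qed

end

subsection \<open>Monotone rearrangements\<close>

lemma measurable_Pair_borel:
  assumes "f \<in> borel_measurable M" "g \<in> borel_measurable M"
  shows "(\<lambda>x. (f x, g x) :: real \<times> real) \<in> M \<rightarrow>\<^sub>M borel"
  using measurable_Pair[OF assms] by (simp add: borel_prod)

lemma measurable_fst_snd_borel [measurable]:
  "fst \<in> (borel :: (real \<times> real) measure) \<rightarrow>\<^sub>M borel"
  "snd \<in> (borel :: (real \<times> real) measure) \<rightarrow>\<^sub>M borel"
  unfolding borel_prod[symmetric] by simp_all

context prob_space
begin

lemma distr_Pair_coupling:
  assumes [measurable]: "X \<in> borel_measurable M" "Y \<in> borel_measurable M"
  shows "distr M borel (\<lambda>\<omega>. (X \<omega>, Y \<omega>)) \<in> couplings (distr M borel X) (distr M borel Y)"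
proof -
  note Pair [measurable] = measurable_Pair_borel[OF assms]
  show ?thesis
    using prob_space_distr[OF Pair] by (simp add: couplings_def distr_distr o_def)
qed

lemma comonotone_coupling_distr_Pair:
  assumes [measurable]: "X \<in> borel_measurable M" "Y \<in> borel_measurable M"
    and comonotone: "\<And>\<omega> \<omega>'. \<omega> \<in> space M \<Longrightarrow> \<omega>' \<in> space M \<Longrightarrow> X \<omega> < X \<omega>' \<Longrightarrow> Y \<omega> \<le> Y \<omega>'"
  shows "comonotone_coupling (distr M borel X) (distr M borel Y) (distr M borel (\<lambda>\<omega>. (X \<omega>, Y \<omega>)))"
  unfolding comonotone_coupling_def
proof (intro conjI allI distr_Pair_coupling assms(1,2))
  fix u v
  define S where "S = {\<omega> \<in> space M. u < X \<omega>}"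
  define T where "T = {\<omega> \<in> space M. v < Y \<omega>}"
  have [measurable]: "S \<in> events" "T \<in> events" by (simp_all add: S_def T_def)
  have "{u<..} \<times> {v<..} \<in> sets (borel :: (real \<times> real) measure)"
    by (simp add: borel_prod[symmetric])
  then have joint: "joint_survival (distr M borel (\<lambda>\<omega>. (X \<omega>, Y \<omega>))) (u, v) = prob (S \<inter> T)"
    by (auto simp: joint_survival_def measure_distr measurable_Pair_borel S_def T_def
        intro!: arg_cong[where f = prob])
  have marginals: "measure (distr M borel X) {u<..} = prob S"
      "measure (distr M borel Y) {v<..} = prob T"
    by (auto simp: measure_distr S_def T_def intro!: arg_cong[where f = prob])
  have "S \<subseteq> T \<or> T \<subseteq> S"
  proof (rule ccontr)
    assume "\<not> ?thesis"
    then obtain \<omega> \<omega>' where "\<omega> \<in> S" "\<omega> \<notin> T" "\<omega>' \<in> T" "\<omega>' \<notin> S" by blast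
    with comonotone[of \<omega>' \<omega>] show False by (auto simp: S_def T_def)
  qed
  then have "prob (S \<inter> T) = min (prob S) (prob T)"
    by (auto simp: Int_absorb1 Int_absorb2 min_absorb1 min_absorb2 finite_measure_mono)
  then show "joint_survival (distr M borel (\<lambda>\<omega>. (X \<omega>, Y \<omega>))) (u, v) =
      min (measure (distr M borel X) {u<..}) (measure (distr M borel Y) {v<..})"
    by (simp only: joint marginals)
qed

end

abbreviation uniform01 :: "real measure" where
  "uniform01 \<equiv> restrict_space lborel {0<..<1}"

lemma prob_space_uniform01: "prob_space uniform01"
  by (auto simp: emeasure_restrict_space space_restrict_space intro!: prob_spaceI)

lemma borel_measurable_uniform01:
  "borel_measurable uniform01 = borel_measurable (restrict_space borel {0<..<1})"
  by (intro measurable_cong_sets sets_restrict_space_cong) auto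

lemma measurable_uniform01_reflect: "(\<lambda>u. 1 - u) \<in> uniform01 \<rightarrow>\<^sub>M uniform01"
  by (rule measurable_restrict_space3) auto

lemma distr_uniform01_reflect: "distr uniform01 uniform01 (\<lambda>u. 1 - u) = uniform01"
proof (rule measure_eqI)
  fix B assume "B \<in> sets (distr uniform01 uniform01 (\<lambda>u. 1 - u))"
  then have B: "B \<in> sets uniform01" and B': "B \<in> sets borel" "B \<subseteq> {0<..<1}"
    by (auto simp: sets_restrict_space_iff)
  have "distr lborel borel (\<lambda>u. 1 - u) = (lborel :: real measure)"
    by (subst (2) lborel_real_affine[of "-1" 1]) (simp_all add: density_1)
  then have "emeasure lborel B = emeasure (distr lborel borel (\<lambda>u. 1 - u)) B" by simp
  also have "\<dots> = emeasure lborel ((\<lambda>u. 1 - u) -` B)" using B' by (simp add: emeasure_distr)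
  also have "(\<lambda>u. 1 - u) -` B = (\<lambda>u. 1 - u) -` B \<inter> space uniform01"
    using B' by (auto simp: space_restrict_space)
  finally show "emeasure (distr uniform01 uniform01 (\<lambda>u. 1 - u)) B = emeasure uniform01 B"
    using B B' by (simp add: emeasure_distr measurable_uniform01_reflect emeasure_restrict_space
        space_restrict_space)
qed simp

lemma mono_on_quantile:
  assumes "real_distribution M"
  shows "mono_on {0<..<1} (quantile M)"
proof -
  interpret cdf_distribution M using assms by (simp add: cdf_distribution_def)
  have "quantile M = (\<lambda>u. Inf {x. u \<le> cdf M x})" by (simp add: quantile_def fun_eq_iff)
  then show ?thesis using mono_I by simp
qed

lemma
  assumes "real_distribution M"
  shows measurable_quantile_uniform01: "quantile M \<in> borel_measurable uniform01"
    and measurable_quantile_reflect_uniform01: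
      "(\<lambda>u. quantile M (1 - u)) \<in> borel_measurable uniform01"
    and distr_quantile: "distr uniform01 borel (quantile M) = M"
    and distr_quantile_reflect: "distr uniform01 borel (\<lambda>u. quantile M (1 - u)) = M"
proof -
  show meas: "quantile M \<in> borel_measurable uniform01"
    and distr: "distr uniform01 borel (quantile M) = M"
    using measurable_quantile[OF assms] by (simp_all add: borel_measurable_uniform01)
  show "(\<lambda>u. quantile M (1 - u)) \<in> borel_measurable uniform01"
    by (rule measurable_compose[OF measurable_uniform01_reflect meas])
  have "distr uniform01 borel (\<lambda>u. quantile M (1 - u)) =
      distr (distr uniform01 uniform01 (\<lambda>u. 1 - u)) borel (quantile M)"
    by (simp add: distr_distr[OF meas measurable_uniform01_reflect] o_def)
  then show "distr uniform01 borel (\<lambda>u. quantile M (1 - u)) = M"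
    by (simp add: distr_uniform01_reflect distr)
qed

lemma comonotone_nondecreasing_rearrangement:
  assumes "real_distribution \<mu>" "real_distribution \<nu>"
  shows "comonotone_coupling \<mu> \<nu> (nondecreasing_rearrangement \<mu> \<nu>)"
proof -
  interpret prob_space uniform01 by (rule prob_space_uniform01)
  have "quantile \<nu> u \<le> quantile \<nu> u'"
    if "u \<in> {0<..<1}" "u' \<in> {0<..<1}" "quantile \<mu> u < quantile \<mu> u'" for u u'
    using that mono_onD[OF mono_on_quantile[OF assms(1)], of u' u]
      mono_onD[OF mono_on_quantile[OF assms(2)], of u u']
    by (cases "u \<le> u'") auto
  then show ?thesis
    using comonotone_coupling_distr_Pair[of "quantile \<mu>" "quantile \<nu>"] assms
    by (simp add: nondecreasing_rearrangement_def measurable_quantile_uniform01 distr_quantile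
        space_restrict_space)
qed

lemma nonincreasing_rearrangement_coupling:
  assumes "real_distribution \<mu>" "real_distribution \<nu>"
  shows "nonincreasing_rearrangement \<mu> \<nu> \<in> couplings \<mu> \<nu>"
proof -
  interpret prob_space uniform01 by (rule prob_space_uniform01)
  show ?thesis
    using distr_Pair_coupling[of "quantile \<mu>" "\<lambda>u. quantile \<nu> (1 - u)"] assms
    by (simp add: nonincreasing_rearrangement_def measurable_quantile_uniform01
        measurable_quantile_reflect_uniform01 distr_quantile distr_quantile_reflect)
qed

subsection \<open>Reflection of the second coordinate\<close>

definition reflect_snd :: "(real \<times> real) measure \<Rightarrow> (real \<times> real) measure" where
  "reflect_snd \<pi> = distr \<pi> borel (\<lambda>z. (fst z, - snd z))"

lemma measurable_reflect_snd [measurable]: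
  "(\<lambda>z. (fst z, - snd z)) \<in> (borel :: (real \<times> real) measure) \<rightarrow>\<^sub>M (borel :: (real \<times> real) measure)"
  by (intro measurable_Pair_borel) measurable

lemma reflect_snd_distr_Pair:
  assumes "f \<in> borel_measurable M" "g \<in> borel_measurable M"
  shows "reflect_snd (distr M borel (\<lambda>x. (f x, g x))) = distr M borel (\<lambda>x. (f x, - g x))"
  unfolding reflect_snd_def
  by (subst distr_distr) (auto intro!: measurable_Pair_borel measurable_reflect_snd assms
      simp: o_def)

lemma reflect_snd_reflect_snd:
  assumes "planar_distribution \<pi>"
  shows "reflect_snd (reflect_snd \<pi>) = \<pi>"
proof -
  interpret planar_distribution \<pi> by fact
  have "reflect_snd (reflect_snd \<pi>) = distr \<pi> borel (\<lambda>z. (fst z, snd z))"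
    by (subst (2) reflect_snd_def) (simp add: reflect_snd_distr_Pair)
  also have "\<dots> = \<pi>" using distr_id2[OF sets_eq_borel[symmetric]] by simp
  finally show ?thesis .
qed

lemma reflect_snd_coupling:
  assumes \<pi>: "\<pi> \<in> couplings \<mu> \<nu>"
  shows "reflect_snd \<pi> \<in> couplings \<mu> (distr \<nu> borel uminus)"
proof -
  interpret planar_distribution \<pi> using \<pi> by (rule planar_distribution_coupling)
  have "distr \<pi> borel fst = \<mu>" "distr (distr \<pi> borel snd) borel uminus = distr \<nu> borel uminus"
    using \<pi> by (simp_all add: couplings_def)
  then show ?thesis
    using distr_Pair_coupling[of fst "\<lambda>z. - snd z"] by (simp add: reflect_snd_def distr_distr o_def)
qed

lemma gw_cost_reflect_snd: "planar_distribution \<pi> \<Longrightarrow> gw_cost (reflect_snd \<pi>) = gw_cost \<pi>"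
  unfolding reflect_snd_def
  by (rule planar_distribution.gw_cost_distr)
    (simp_all add: measurable_reflect_snd distortion_def power2_commute)

lemma comonotone_reflect_nonincreasing_rearrangement:
  assumes "real_distribution \<mu>" "real_distribution \<nu>"
  shows "comonotone_coupling \<mu> (distr \<nu> borel uminus)
    (reflect_snd (nonincreasing_rearrangement \<mu> \<nu>))"
proof -
  interpret prob_space uniform01 by (rule prob_space_uniform01)
  note meas = measurable_quantile_uniform01[OF assms(1)]
    measurable_quantile_reflect_uniform01[OF assms(2)]
  have mono: "- quantile \<nu> (1 - u) \<le> - quantile \<nu> (1 - u')"
    if "u \<in> {0<..<1}" "u' \<in> {0<..<1}" "quantile \<mu> u < quantile \<mu> u'" for u u'
    using that mono_onD[OF mono_on_quantile[OF assms(1)], of u' u]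
      mono_onD[OF mono_on_quantile[OF assms(2)], of "1 - u'" "1 - u"]
    by (cases "u \<le> u'") auto
  have "distr uniform01 borel (\<lambda>u. - quantile \<nu> (1 - u)) =
      distr (distr uniform01 borel (\<lambda>u. quantile \<nu> (1 - u))) borel uminus"
    using meas by (simp add: distr_distr o_def)
  then show ?thesis
    using comonotone_coupling_distr_Pair[of "quantile \<mu>" "\<lambda>u. - quantile \<nu> (1 - u)"] meas mono assms
    by (simp add: nonincreasing_rearrangement_def reflect_snd_distr_Pair distr_quantile
        distr_quantile_reflect space_restrict_space)
qed

subsection \<open>Optimality of the monotone rearrangements\<close>

context two_clusters
begin

lemmas nondecreasing_comonotone =
  comonotone_nondecreasing_rearrangement[OF mu.real_distribution_axioms nu.real_distribution_axioms]
lemmas nonincreasing_coupling =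
  nonincreasing_rearrangement_coupling[OF mu.real_distribution_axioms nu.real_distribution_axioms]

lemma joint_survival_reflect_snd:
  assumes \<pi>: "\<pi> \<in> couplings \<mu> \<nu>"
  shows "joint_survival (reflect_snd \<pi>) (a + R, - (b + K)) = cross_mass \<pi>"
proof -
  interpret planar_distribution \<pi> using \<pi> by (rule planar_distribution_coupling)
  have "(\<lambda>z. (fst z, - snd z)) -` ({a + R<..} \<times> {- (b + K)<..}) = {a + R<..} \<times> {..<b + K}" by auto
  moreover have "{a + R<..} \<times> {- (b + K)<..} \<in> sets (borel :: (real \<times> real) measure)"
    by (simp add: borel_prod[symmetric])
  ultimately have "joint_survival (reflect_snd \<pi>) (a + R, - (b + K)) =
      prob ({a + R<..} \<times> {..<b + K})"
    by (simp add: joint_survival_def reflect_snd_def measure_distr measurable_Pair_borel)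
  also have "\<dots> = prob ({a + R<..} \<times> {..b + R})"
  proof (rule finite_measure_eq_AE)
    show "AE z in \<pi>. (z \<in> {a + R<..} \<times> {..<b + K}) = (z \<in> {a + R<..} \<times> {..b + R})"
      using AE_coupling_clusters[OF \<pi>]
      by eventually_elim (use mu.separated in \<open>auto simp: mem_Times_iff\<close>)
  qed auto
  also have "\<dots> = cross_mass \<pi>" using cross_mass_eq_downward[OF \<pi>] by simp
  finally show ?thesis .
qed

lemma nonincreasing_cost_less:
  assumes "t = 1 / 2" and \<pi>: "\<pi> \<in> couplings \<mu> \<nu>" and "\<pi> \<noteq> nonincreasing_rearrangement \<mu> \<nu>"
    and "\<kappa> \<le> cross_mass \<pi> / 2" "50 * R \<le> K * \<kappa>"
  shows "gw_cost (nonincreasing_rearrangement \<mu> \<nu>) < gw_cost \<pi>"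
proof -
  let ?dec = "nonincreasing_rearrangement \<mu> \<nu>"
  note planar = planar_distribution_coupling[OF \<pi>]
    planar_distribution_coupling[OF nonincreasing_coupling]
  have "two_cluster_distribution (distr \<nu> borel uminus) (- (b + K + R)) R K t"
    using nu.two_cluster_distribution_uminus by (simp only: \<open>t = 1 / 2\<close>) simp
  then interpret reflected: two_clusters \<mu> "distr \<nu> borel uminus" a "- (b + K + R)" R K t
    by (intro two_clusters.intro mu.two_cluster_distribution_axioms)
  have "reflected.cross_mass (reflect_snd \<pi>) = t - cross_mass \<pi>"
    using reflected.joint_survival_cluster_ends[OF reflect_snd_coupling[OF \<pi>]]
      joint_survival_reflect_snd[OF \<pi>] by simp
  then have margin: "\<kappa> \<le> 1 / 4 - reflected.cross_mass (reflect_snd \<pi>) / 2" "\<kappa> \<le> t" "\<kappa> \<le> 1 - t"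
    using \<open>t = 1 / 2\<close> \<open>\<kappa> \<le> cross_mass \<pi> / 2\<close> cross_mass_bounds[OF \<pi>] by linarith+
  have "reflect_snd \<pi> \<noteq> reflect_snd ?dec"
    using assms(3) by (metis reflect_snd_reflect_snd planar)
  then have "gw_cost (reflect_snd ?dec) < gw_cost (reflect_snd \<pi>)"
    by (intro reflected.comonotone_cost_less[where \<kappa> = \<kappa>] reflect_snd_coupling \<pi> margin
        comonotone_reflect_nonincreasing_rearrangement assms(5)
        mu.real_distribution_axioms nu.real_distribution_axioms)
  then show ?thesis by (simp add: gw_cost_reflect_snd planar)
qed

end

definition cluster_margin :: "real \<Rightarrow> real" where
  "cluster_margin t =
    (if t = 1 / 2 then 1 / 8 else min (min t (1 - t)) (1 / 4 - min t (1 - t) / 2))"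

lemma cluster_margin_pos: "0 < t \<Longrightarrow> t < 1 \<Longrightarrow> 0 < cluster_margin t"
  by (auto simp: cluster_margin_def min_def)

lemma cluster_margin_le: "cluster_margin t \<le> t" "cluster_margin t \<le> 1 - t"
  by (auto simp: cluster_margin_def)

lemma is_arg_min_two_candidates:
  fixes f :: "'a \<Rightarrow> 'b :: linorder"
  assumes "P x" "P y" and "\<And>z. P z \<Longrightarrow> z \<noteq> x \<Longrightarrow> z \<noteq> y \<Longrightarrow> f x < f z \<or> f y < f z"
  shows "\<exists>z. is_arg_min f P z" and "is_arg_min f P z \<Longrightarrow> z = x \<or> z = y"
    and "f x \<noteq> f y \<Longrightarrow> \<exists>!z. is_arg_min f P z"
proof -
  show cands: "z = x \<or> z = y" if "is_arg_min f P z" for z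
    using that assms by (force simp: is_arg_min_linorder)
  have "is_arg_min f P (if f x \<le> f y then x else y)"
    using assms by (force simp: is_arg_min_linorder)
  then show ex: "\<exists>z. is_arg_min f P z" ..
  show "\<exists>!z. is_arg_min f P z" if "f x \<noteq> f y"
  proof (rule ex_ex1I[OF ex])
    fix z z' assume "is_arg_min f P z" "is_arg_min f P z'"
    moreover from this have "f z = f z'" by (auto simp: is_arg_min_linorder intro: antisym)
    ultimately show "z = z'" using cands that by metis
  qed
qed

context two_clusters
begin

lemma cluster_margin_le_cross_mass:
  assumes "t \<noteq> 1 / 2" "\<pi> \<in> couplings \<mu> \<nu>"
  shows "cluster_margin t \<le> 1 / 4 - cross_mass \<pi> / 2"
proof -
  have "cross_mass \<pi> \<le> min t (1 - t)" using cross_mass_bounds[OF assms(2)] by simp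
  moreover have "cluster_margin t \<le> 1 / 4 - min t (1 - t) / 2"
    using \<open>t \<noteq> 1 / 2\<close> by (simp add: cluster_margin_def)
  ultimately show ?thesis
    by (elim order_trans) (intro diff_left_mono divide_right_mono; simp)
qed

theorem gw_optimal_monotone_rearrangement:
  assumes t: "0 < t" "t < 1" and K: "50 * R \<le> K * cluster_margin t"
  defines "\<pi>_inc \<equiv> nondecreasing_rearrangement \<mu> \<nu>" and "\<pi>_dec \<equiv> nonincreasing_rearrangement \<mu> \<nu>"
  shows "(\<exists>\<pi>. gw_optimal \<mu> \<nu> \<pi>) \<and> (\<forall>\<pi>. gw_optimal \<mu> \<nu> \<pi> \<longrightarrow> \<pi> = \<pi>_inc \<or> \<pi> = \<pi>_dec) \<and>
    (t \<noteq> 1 / 2 \<or> gw_cost \<pi>_inc \<noteq> gw_cost \<pi>_dec \<longrightarrow> (\<exists>!\<pi>. gw_optimal \<mu> \<nu> \<pi>))"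
proof -
  have inc: "\<pi>_inc \<in> couplings \<mu> \<nu>" and dec: "\<pi>_dec \<in> couplings \<mu> \<nu>"
    using comonotone_couplingD[OF nondecreasing_comonotone] nonincreasing_coupling
    by (simp_all add: \<pi>_inc_def \<pi>_dec_def)
  have inc_less: "gw_cost \<pi>_inc < gw_cost \<pi>"
    if "\<pi> \<in> couplings \<mu> \<nu>" "\<pi> \<noteq> \<pi>_inc" "cluster_margin t \<le> 1 / 4 - cross_mass \<pi> / 2" for \<pi>
    unfolding \<pi>_inc_def using that K t
    by (intro comonotone_cost_less[where \<kappa> = "cluster_margin t"] nondecreasing_comonotone)
      (auto simp: \<pi>_inc_def cluster_margin_pos cluster_margin_le)
  show ?thesis
  proof (cases "t = 1 / 2")
    case True
    have "gw_cost \<pi>_inc < gw_cost \<pi> \<or> gw_cost \<pi>_dec < gw_cost \<pi>"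
      if "\<pi> \<in> couplings \<mu> \<nu>" "\<pi> \<noteq> \<pi>_inc" "\<pi> \<noteq> \<pi>_dec" for \<pi>
    proof (cases "cross_mass \<pi> \<le> 1 / 4")
      case True
      then show ?thesis using inc_less[of \<pi>] that \<open>t = 1 / 2\<close> by (simp add: cluster_margin_def)
    next
      case False
      then show ?thesis
        using nonincreasing_cost_less[of \<pi> "1 / 8"] that \<open>t = 1 / 2\<close> K
        by (simp add: \<pi>_dec_def cluster_margin_def)
    qed
    from is_arg_min_two_candidates[OF inc dec this] True show ?thesis
      unfolding gw_optimal_def by blast
  next
    case False
    have "gw_cost \<pi>_inc < gw_cost \<pi>" if "\<pi> \<in> couplings \<mu> \<nu>" "\<pi> \<noteq> \<pi>_inc" for \<pi>
      using inc_less[OF that] cluster_margin_le_cross_mass[OF False that(1)] .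
    then have "gw_optimal \<mu> \<nu> \<pi> \<longleftrightarrow> \<pi> = \<pi>_inc" for \<pi>
      using inc by (force simp: gw_optimal_def is_arg_min_linorder)
    then show ?thesis by auto
  qed
qed

end

lemma bounded_subset_Icc_diameter:
  fixes A :: "real set"
  assumes "bounded A"
  shows "\<exists>a. A \<subseteq> {a..a + diameter A}"
proof -
  have "x \<le> Inf A + diameter A" if "x \<in> A" for x
  proof -
    have "x - diameter A \<le> y" if "y \<in> A" for y
      using diameter_bounded_bound[OF assms \<open>x \<in> A\<close> that] by (simp add: dist_real_def)
    then have "x - diameter A \<le> Inf A" using that by (intro cInf_greatest) auto
    then show ?thesis by simp
  qed
  moreover have "Inf A \<le> x" if "x \<in> A" for x
    using that assms by (intro cInf_lower bounded_imp_bdd_below)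
  ultimately have "A \<subseteq> {Inf A..Inf A + diameter A}" by auto
  then show ?thesis ..
qed

abbreviation (input) shifted_mixture ::
    "real \<Rightarrow> real \<Rightarrow> real measure \<Rightarrow> real measure \<Rightarrow> real measure" where
  "shifted_mixture t K M N \<equiv> mixture t M (distr N borel (\<lambda>x. x + K))"

lemma ex_two_clusters_threshold:
  fixes A :: "real set" and \<mu>\<^sub>1 \<mu>\<^sub>2 \<nu>\<^sub>1 \<nu>\<^sub>2 :: "real measure"
  assumes "bounded A" and t: "0 < t" "t < 1"
    and \<mu>\<^sub>1: "real_distribution \<mu>\<^sub>1" "AE x in \<mu>\<^sub>1. x \<in> A"
      and \<mu>\<^sub>2: "real_distribution \<mu>\<^sub>2" "AE x in \<mu>\<^sub>2. x \<in> A"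
    and \<nu>\<^sub>1: "real_distribution \<nu>\<^sub>1" "AE y in \<nu>\<^sub>1. y \<in> A"
      and \<nu>\<^sub>2: "real_distribution \<nu>\<^sub>2" "AE y in \<nu>\<^sub>2. y \<in> A"
  shows "\<exists>K\<^sub>0\<ge>diameter A. \<forall>K>K\<^sub>0. \<exists>a R. 50 * R \<le> K * cluster_margin t \<and>
    two_clusters (shifted_mixture t K \<mu>\<^sub>1 \<mu>\<^sub>2) (shifted_mixture t K \<nu>\<^sub>1 \<nu>\<^sub>2) a a R K t"
proof -
  let ?\<kappa> = "cluster_margin t"
  have \<kappa>: "0 < ?\<kappa>" "?\<kappa> \<le> 1" using cluster_margin_pos cluster_margin_le[of t] t by auto
  define R where "R = diameter A + 1"
  obtain a where "A \<subseteq> {a..a + diameter A}" using bounded_subset_Icc_diameter[OF \<open>bounded A\<close>] ..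
  then have A: "A \<subseteq> {a..a + R}" and "0 < R"
    using diameter_ge_0[OF \<open>bounded A\<close>] by (auto simp: R_def)
  have supp: "AE x in M. x \<in> {a..a + R}" if "AE x in M. x \<in> A" for M :: "real measure"
    using that by eventually_elim (use A in blast)
  have "R * ?\<kappa> \<le> R * 1" using \<kappa> \<open>0 < R\<close> by (intro mult_left_mono) auto
  then have R_le: "R \<le> 50 * R / ?\<kappa>" using \<kappa> \<open>0 < R\<close> by (simp add: field_simps)
  show ?thesis
  proof (intro exI conjI allI impI)
    show "diameter A \<le> 50 * R / ?\<kappa>" using R_le by (simp add: R_def)
    fix K assume K: "50 * R / ?\<kappa> < K"
    then show "50 * R \<le> K * ?\<kappa>" using \<kappa> by (simp add: field_simps)
    have "R < K" using R_le K by linarith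
    then show "two_clusters (shifted_mixture t K \<mu>\<^sub>1 \<mu>\<^sub>2)
        (shifted_mixture t K \<nu>\<^sub>1 \<nu>\<^sub>2) a a R K t"
      using \<open>0 < R\<close> t
      by (intro two_clusters.intro two_cluster_distribution_mixture supp \<mu>\<^sub>1 \<mu>\<^sub>2 \<nu>\<^sub>1 \<nu>\<^sub>2) auto
  qed
qed

theorem proposition3p14:
  fixes A :: "real set" and \<mu>1 \<mu>2 \<nu>1 \<nu>2 :: "real measure" and t :: real
  assumes "compact A" and "is_interval A"
    and "real_distribution \<mu>1" and "AE x in \<mu>1. x \<in> A"
    and "real_distribution \<mu>2" and "AE x in \<mu>2. x \<in> A"
    and "real_distribution \<nu>1" and "AE y in \<nu>1. y \<in> A"
    and "real_distribution \<nu>2" and "AE y in \<nu>2. y \<in> A"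
    and "0 < t" and "t < 1"
  shows "\<exists>K0 \<ge> diameter A. \<forall>K > K0.
    (let \<mu> = mixture t \<mu>1 (distr \<mu>2 borel (\<lambda>x. x + K));
         \<nu> = mixture t \<nu>1 (distr \<nu>2 borel (\<lambda>x. x + K));
         \<pi>_inc = nondecreasing_rearrangement \<mu> \<nu>;
         \<pi>_dec = nonincreasing_rearrangement \<mu> \<nu>
     in (\<exists>\<pi>. gw_optimal \<mu> \<nu> \<pi>) \<and>
        (\<forall>\<pi>. gw_optimal \<mu> \<nu> \<pi> \<longrightarrow> \<pi> = \<pi>_inc \<or> \<pi> = \<pi>_dec) \<and>
        (t \<noteq> 1 / 2 \<or> gw_cost \<pi>_inc \<noteq> gw_cost \<pi>_dec \<longrightarrow> (\<exists>!\<pi>. gw_optimal \<mu> \<nu> \<pi>)))"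
proof -
  let "\<exists>K0 \<ge> diameter A. \<forall>K > K0. ?optimal K" = ?thesis
  obtain K0 where "diameter A \<le> K0"
    and threshold: "\<forall>K>K0. \<exists>a R. 50 * R \<le> K * cluster_margin t \<and>
      two_clusters (shifted_mixture t K \<mu>1 \<mu>2) (shifted_mixture t K \<nu>1 \<nu>2) a a R K t"
    using ex_two_clusters_threshold[OF compact_imp_bounded[OF assms(1)] assms(11,12,3-10)] by blast
  have "?optimal K" if K: "K0 < K" for K
  proof -
    obtain a R where "50 * R \<le> K * cluster_margin t" and "two_clusters (shifted_mixture t K \<mu>1 \<mu>2)
        (shifted_mixture t K \<nu>1 \<nu>2) a a R K t"
      using threshold K by blast
    then show ?thesis
      unfolding Let_def by (intro two_clusters.gw_optimal_monotone_rearrangement \<open>0 < t\<close> \<open>t < 1\<close>)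
  qed
  with \<open>diameter A \<le> K0\<close> show ?thesis by blast
qed

end
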